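(* For every integer $n\ge 2$, the valuation matrix $\mathbf{A}_n$ satisfies $\operatorname{rank}(\mathbf{A}_n)=n-1$ (rank over $\mathbb{Q}$).
   Context: For a prime $p$, $\mathbf{v}_p$ denotes the $p$-adic valuation on $\mathbb{Q}$. For $n\in\mathbb{N}$ let $\mathcal{P}_n$ be the set of prime numbers $p\le n$. For $p\in\mathcal{P}_n$ let $r_{n,p}$ be the integer with $0\le r_{n,p}<p$ and $n\equiv r_{n,p}\bmod p$, and let $$\mathcal{R}_{n,p}=\begin{cases}\{1,2\} & \text{if } n=2^s\text{ with } s>1 \text{ and } p=2,\\ \{1,2,3,4\} & \text{if } n=9\text{ and } p=3,\\ \{r\in\mathbb{Z}\mid 1\le r\le p-r_{n,p}-1\} & \text{otherwise.}\end{cases}$$ For $n\ge 2$ the valuation matrix $\mathbf{A}_n$ of $n$ is the integer matrix whose rows are indexed by the pairs $(p,r)$ with $p\in\mathcal{P}_n$, $r\in\mathcal{R}_{n,p}$ (in some fixed order), whose columns are indexed by $0\le j\le n-1$, and whose entry in row $(p,r)$ and column $j$ is $\mathbf{v}_p(n+r-j)-\mathbf{v}_p(n-j)$. *)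

theory Defs
  imports
    "Jordan_Normal_Form.DL_Rank"
    "HOL-Computational_Algebra.Primes"
begin

definition primes_upto :: "nat \<Rightarrow> nat set" where
  "primes_upto n = {p. prime p \<and> p \<le> n}"

(* r_{n,p} is n mod p; for prime p we have n mod p < p, so the natural-number
   subtraction in the last case never truncates. *)
definition row_shifts :: "nat \<Rightarrow> nat \<Rightarrow> nat set" where
  "row_shifts n p =
    (if (\<exists>s>1. n = 2 ^ s) \<and> p = 2 then {1, 2}
     else if n = 9 \<and> p = 3 then {1, 2, 3, 4}
     else {1..p - n mod p - 1})"

definition row_index :: "nat \<Rightarrow> (nat \<times> nat) set" where
  "row_index n = Sigma (primes_upto n) (row_shifts n)"

(* The list fixes the order of the rows (p, r); row i belongs to the i-th pair.
   Column indices satisfy j < n, so the arguments of multiplicity are positive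
   and the subtractions inside them do not truncate; there multiplicity p is the
   p-adic valuation. *)
definition valuation_matrix :: "nat \<Rightarrow> (nat \<times> nat) list \<Rightarrow> int mat" where
  "valuation_matrix n prs =
    mat (length prs) n (\<lambda>(i, j). case prs ! i of (p, r) \<Rightarrow>
      int (multiplicity p (n + r - j)) - int (multiplicity p (n - j)))"

definition rat_rank :: "int mat \<Rightarrow> nat" where
  "rat_rank A = vec_space.rank (dim_row A) (map_mat rat_of_int A)"

end

theory Submission
  imports Defs "HOL-Analysis.Harmonic_Numbers"
begin

text \<open>
  Index the columns by \<open>m = n - j\<close>. The constant vectors lie in the kernel of the matrix, because
  \<open>p\<close> does not divide \<open>(n + r) choose r\<close> for a row \<open>(p, r)\<close>; the point is that every
  kernel vector \<open>y\<close> is constant. A prime \<open>P\<close> with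
  \<open>n < 2P\<close> forces \<open>y\<close> to be constant on \<open>n - P < m \<le> P\<close>; subtract this
  constant. If now \<open>y\<close> is supported on the first \<open>k\<close> and the last \<open>k\<close> indices and
  some prime \<open>p > 2k\<close> divides one of \<open>n, n - 1, \<dots>, n - k + 1\<close>, then the rows of
  \<open>p\<close> show that the support shrinks from \<open>k\<close> to \<open>n mod p < k\<close>. So it remains to show
  that such a prime exists whenever \<open>n > 10\<close>, \<open>k \<ge> 2\<close> and these \<open>k\<close> numbers are
  composite; powers of two (\<open>k = 1\<close>), \<open>9\<close> and \<open>10\<close> are treated by hand.

  Suppose that \<open>n, \<dots>, n - k + 1\<close> are composite and have no prime factor above \<open>2k\<close>.
  Discarding for every prime the term of largest valuation (Erdos) gives
  \<open>(n - k + 1)^(k - pi(2k)) \<le> (k - 1)!\<close>, which leaves finitely many cases for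
  \<open>5 \<le> k < 200\<close> and, with \<open>pi(2k) \<le> k/2\<close>, yields \<open>n \<le> k\<^sup>2\<close> for larger
  \<open>k\<close>. In this range the primes dividing \<open>n choose k\<close> are at most \<open>min (2k) (n/2)\<close>,
  and a Chebyshev bound \<open>theta(x) \<le> 1.1062 x + O(ln x)\<close> contradicts the size of
  \<open>n choose k\<close>. The margin is narrow at \<open>n = 4k\<close>, so \<open>n < 2^18\<close> needs an
  explicit list of primes with small gaps. For \<open>k \<le> 4\<close> two of the numbers are of the form
  \<open>2^a 3^b\<close>, and such numbers are rarely close to each other.
\<close>

section \<open>Rank and kernel\<close>

hide_const (open) Finite_Cartesian_Product.vec Finite_Cartesian_Product.mat
hide_type (open) Finite_Cartesian_Product.vec
unbundle no vec_syntax

context vec_space begin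

text \<open>The all-ones vector makes the columns dependent. Without the last column they are
  independent: a relation, extended by 0, is a kernel vector, hence constant and equal to its last
  entry 0. Independence concerns the set of columns, so these must be distinct; equal columns would
  give a kernel vector with entries 1 and -1.\<close>

lemma rank_eq_pred_if_kernel_constant:
  assumes A: "A \<in> carrier_mat n nc" and nc: "2 \<le> nc" and char: "(1::'a) \<noteq> - 1"
    and one: "A *\<^sub>v vec nc (\<lambda>_. 1) = 0\<^sub>v n"
    and ker: "\<And>v i. v \<in> carrier_vec nc \<Longrightarrow> A *\<^sub>v v = 0\<^sub>v n \<Longrightarrow> i < nc \<Longrightarrow> v $ i = v $ 0"
  shows "rank A = nc - 1"
proof -
  have dist: "distinct (cols A)"
  proof (rule ccontr)
    assume "\<not> distinct (cols A)"
    then obtain i j where ij: "i < nc" "j < nc" "i \<noteq> j" "col A i = col A j"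
      using A unfolding distinct_conv_nth by auto
    define v :: "'a vec" where "v = unit_vec nc i - unit_vec nc j"
    have v: "v \<in> carrier_vec nc" by (auto simp: v_def)
    have unit: "A *\<^sub>v unit_vec nc l = col A l" if "l < nc" for l
      using that A by (intro eq_vecI) auto
    have "A *\<^sub>v v = A *\<^sub>v unit_vec nc i - A *\<^sub>v unit_vec nc j"
      unfolding v_def using A by (intro mult_minus_distrib_mat_vec) auto
    also have "\<dots> = col A i - col A j"
      using ij by (simp add: unit)
    also have "\<dots> = 0\<^sub>v n" using ij A by auto
    finally have "A *\<^sub>v v = 0\<^sub>v n" .
    from ker[OF v this ij(1)] ker[OF v this ij(2)] have "v $ i = v $ j" by simp
    thus False using ij char unfolding v_def by simp
  qed
  have "rank A \<noteq> nc"
  proof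
    assume "rank A = nc"
    from full_rank_lin_indpt[OF A this dist] have "lin_indpt (set (cols A))" .
    moreover have "lin_dep (set (cols A))"
    proof (rule lin_depI[OF A _ _ one dist])
      show "vec nc (\<lambda>_. 1) \<noteq> (0\<^sub>v nc :: 'a vec)"
      proof
        assume "vec nc (\<lambda>_. 1) = (0\<^sub>v nc :: 'a vec)"
        hence "vec nc (\<lambda>_. 1) $ 0 = (0\<^sub>v nc :: 'a vec) $ 0" by simp
        thus False using nc by simp
      qed
    qed simp
    ultimately show False by simp
  qed
  with rank_le_nc[OF A] have le: "rank A \<le> nc - 1" by simp
  define B where "B = mat n (nc - 1) (\<lambda>(i, j). A $$ (i, j))"
  have B: "B \<in> carrier_mat n (nc - 1)" by (simp add: B_def)
  have colB: "col B j = col A j" if "j < nc - 1" for j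
    using that A unfolding B_def by (intro eq_vecI) auto
  have cB: "cols B = take (nc - 1) (cols A)"
    using A B colB by (intro nth_equalityI) auto
  have distB: "distinct (cols B)" using dist unfolding cB by simp
  have sub: "set (cols B) \<subseteq> set (cols A)" unfolding cB by (rule set_take_subset)
  have indep: "lin_indpt (set (cols B))"
  proof
    assume "lin_dep (set (cols B))"
    from lin_depE[OF B this distB] obtain v
      where v: "v \<in> carrier_vec (nc - 1)" "v \<noteq> 0\<^sub>v (nc - 1)" "B *\<^sub>v v = 0\<^sub>v n" .
    define w where "w = vec nc (\<lambda>i. if i < nc - 1 then v $ i else 0)"
    have w: "w \<in> carrier_vec nc" by (simp add: w_def)
    have "A *\<^sub>v w = B *\<^sub>v v"
    proof (rule eq_vecI)
      fix i assume "i < dim_vec (B *\<^sub>v v)"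
      hence i: "i < n" using B by simp
      have "(A *\<^sub>v w) $ i = (\<Sum>j = 0..<Suc (nc - 1). A $$ (i, j) * w $ j)"
        using i A w nc by (simp add: scalar_prod_def del: sum.op_ivl_Suc)
      also have "\<dots> = (\<Sum>j = 0..<nc - 1. A $$ (i, j) * w $ j)"
        using nc unfolding sum.op_ivl_Suc by (simp add: w_def)
      also have "\<dots> = (\<Sum>j = 0..<nc - 1. B $$ (i, j) * v $ j)"
        using i by (intro sum.cong) (auto simp: w_def B_def)
      also have "\<dots> = (B *\<^sub>v v) $ i"
        using i B v(1) by (simp add: scalar_prod_def)
      finally show "(A *\<^sub>v w) $ i = (B *\<^sub>v v) $ i" .
    qed (use A B in auto)
    with v have Aw: "A *\<^sub>v w = 0\<^sub>v n" by simp
    have const: "w $ i = 0" if "i < nc" for i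
      using ker[OF w Aw that] ker[OF w Aw, of "nc - 1"] nc by (simp add: w_def)
    have "v = 0\<^sub>v (nc - 1)"
    proof (rule eq_vecI)
      fix i assume "i < dim_vec (0\<^sub>v (nc - 1) :: 'a vec)"
      thus "v $ i = 0\<^sub>v (nc - 1) $ i" using const[of i] by (simp add: w_def)
    qed (use v in simp)
    with v show False by simp
  qed
  have "card (set (cols B)) = nc - 1" using distinct_card[OF distB] B by simp
  with rank_ge_card_indpt[OF A sub indep] le show ?thesis by simp
qed

end

section \<open>An upper bound for Chebyshev's theta function\<close>

lemma multiplicity_eq_card_prime_powers:
  fixes p n :: nat
  assumes "prime p" "0 < n" "n < p ^ Suc b"
  shows "multiplicity p n = card {e \<in> {1..b}. p ^ e dvd n}"
proof -
  have le: "multiplicity p n \<le> b"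
  proof (rule ccontr)
    assume "\<not> ?thesis"
    hence "p ^ Suc b dvd n" by (intro multiplicity_dvd') simp
    with assms show False by (auto dest: dvd_imp_le)
  qed
  have "{e \<in> {1..b}. p ^ e dvd n} = {1..multiplicity p n}"
    using le assms multiplicity_geI[of n p] multiplicity_dvd'[of _ p n]
    prime_gt_1_nat[OF assms(1)] by auto
  thus ?thesis by simp
qed

text \<open>Legendre's formula by induction: passing to \<open>Suc n\<close> raises by one exactly
  those quotients whose \<open>p ^ e\<close> divides \<open>Suc n\<close>.\<close>

lemma multiplicity_fact:
  fixes p n :: nat
  assumes "prime p" "n < p ^ Suc b"
  shows "multiplicity p (fact n) = (\<Sum>e = 1..b. n div p ^ e)"
  using assms(2)
proof (induction n)
  case (Suc n)
  have "multiplicity p (fact (Suc n)) = multiplicity p (Suc n) + multiplicity p (fact n)"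
    using assms(1) by (simp only: fact_Suc of_nat_id) (subst prime_elem_multiplicity_mult_distrib; simp)
  also have "\<dots> = card {e \<in> {1..b}. p ^ e dvd Suc n} + (\<Sum>e = 1..b. n div p ^ e)"
    using Suc assms(1) by (simp add: multiplicity_eq_card_prime_powers)
  also have "card {e \<in> {1..b}. p ^ e dvd Suc n} = (\<Sum>e = 1..b. if p ^ e dvd Suc n then 1 else 0)"
    by (simp add: sum.If_cases Int_def)
  also have "\<dots> + (\<Sum>e = 1..b. n div p ^ e) = (\<Sum>e = 1..b. Suc n div p ^ e)"
    unfolding sum.distrib[symmetric] using assms(1)
    by (intro sum.cong refl) (auto simp: div_Suc dvd_eq_mod_eq_0 prime_gt_0_nat)
  finally show ?case .
qed simp

definition theta :: "nat \<Rightarrow> real" where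
  "theta x = (\<Sum>p | prime p \<and> p \<le> x. ln (real p))"

lemma finite_primes_le [simp]: "finite {p::nat. prime p \<and> p \<le> x}"
  by (rule finite_subset[of _ "{..x}"]) auto

lemma theta_mono: "x \<le> y \<Longrightarrow> theta x \<le> theta y"
  unfolding theta_def by (rule sum_mono2) (auto dest: prime_ge_1_nat)

text \<open>Since \<open>1/2 + 1/3 + 1/7 + 1/42 = 1\<close>, the exponent of a prime \<open>p\<close> in
  \<open>(42m)! / ((21m)! (14m)! (6m)! m!)\<close> is at least the number of powers \<open>p^e\<close> such that
  \<open>42\<close> does not divide \<open>(42m) div p^e\<close>.\<close>

definition multinom42 :: "nat \<Rightarrow> nat" where
  "multinom42 m = (42 * m choose 21 * m) * (21 * m choose 14 * m) * (7 * m choose 6 * m)"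

lemma multinom42_fact:
  "multinom42 m * (fact (21 * m) * fact (14 * m) * fact (6 * m) * fact m) = fact (42 * m)"
proof -
  have 1: "fact (42 * m) = fact (21 * m) * fact (21 * m) * (42 * m choose 21 * m)"
    using binomial_fact_lemma[of "21 * m" "42 * m"] by simp
  have 2: "fact (21 * m) = fact (14 * m) * fact (7 * m) * (21 * m choose 14 * m)"
    using binomial_fact_lemma[of "14 * m" "21 * m"] by simp
  have 3: "fact (7 * m) = fact (6 * m) * fact m * (7 * m choose 6 * m)"
    using binomial_fact_lemma[of "6 * m" "7 * m"] by simp
  have "fact (42 * m) = fact (21 * m) * (fact (14 * m) * (fact (6 * m) * fact m
      * (7 * m choose 6 * m)) * (21 * m choose 14 * m)) * (42 * m choose 21 * m)"
    using 1 2 3 by simp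
  thus ?thesis unfolding multinom42_def by (simp add: mult_ac)
qed

lemma multinom42_pos: "multinom42 m > 0"
  unfolding multinom42_def by simp

text \<open>The power e = 1 already contributes to the exponent, because \<open>42 * m div p\<close>
  lies between 1 and 41.\<close>

lemma prime_dvd_multinom42:
  fixes p m :: nat
  assumes p: "prime p" and "m < p" "p \<le> 42 * m"
  shows "p dvd multinom42 m"
proof -
  define b where "b = 42 * m"
  have less: "n < p ^ Suc b" if "n \<le> 42 * m" for n
  proof -
    have "n < 2 ^ Suc b" using that less_exp[of "Suc b"] unfolding b_def by linarith
    also have "\<dots> \<le> p ^ Suc b" using prime_ge_2_nat[OF p] by (rule power_mono) simp
    finally show ?thesis .
  qed
  have b1: "1 \<le> b" using assms unfolding b_def by auto
  let ?f = "\<lambda>e. 42 * m div p ^ e"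
  let ?g = "\<lambda>e. 21 * m div p ^ e + 14 * m div p ^ e + 6 * m div p ^ e + m div p ^ e"
  have split: "?g e = ?f e div 2 + ?f e div 3 + ?f e div 7 + ?f e div 42" for e
  proof -
    have d: "?f e div a = 42 * m div a div p ^ e" for a
      by (simp add: div_mult2_eq[symmetric] mult.commute)
    show ?thesis unfolding d by simp
  qed
  have le: "x div 2 + x div 3 + x div 7 + x div 42 \<le> x" for x :: nat
    using div_times_less_eq_dividend[of x 2] div_times_less_eq_dividend[of x 3]
      div_times_less_eq_dividend[of x 7] div_times_less_eq_dividend[of x 42] by linarith
  \<comment> \<open>Below 42 the last quotient is 0, and 1/2 + 1/3 + 1/7 = 41/42.\<close>
  have lt: "x div 2 + x div 3 + x div 7 + x div 42 < x" if "1 \<le> x" "x < 42" for x :: nat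
    using that div_times_less_eq_dividend[of x 2] div_times_less_eq_dividend[of x 3]
      div_times_less_eq_dividend[of x 7] by simp
  have "?f 1 \<ge> 1" using assms by (simp add: div_greater_zero_iff Suc_le_eq)
  moreover have "?f 1 < 42" using assms by (simp add: div_less_iff_less_mult prime_gt_0_nat)
  ultimately have "?g 1 < ?f 1" unfolding split by (rule lt)
  have le': "?g e \<le> ?f e" for e unfolding split by (rule le)
  have "(\<Sum>e = 1..b. ?g e) < (\<Sum>e = 1..b. ?f e)"
    by (rule sum_strict_mono_ex1) (use le' \<open>?g 1 < ?f 1\<close> b1 in \<open>auto intro!: bexI[of _ 1]\<close>)
  moreover have "multiplicity p (fact (42 * m) :: nat) = multiplicity p (multinom42 m)
      + (multiplicity p (fact (21 * m)) + multiplicity p (fact (14 * m))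
         + multiplicity p (fact (6 * m)) + multiplicity p (fact m))"
    using p multinom42_pos[of m] unfolding multinom42_fact[of m, symmetric]
    by (simp add: prime_elem_multiplicity_mult_distrib)
  ultimately have "multiplicity p (multinom42 m) > 0"
    using multiplicity_fact[OF p less, of "42 * m"] multiplicity_fact[OF p less, of "21 * m"]
      multiplicity_fact[OF p less, of "14 * m"] multiplicity_fact[OF p less, of "6 * m"]
      multiplicity_fact[OF p less, of m]
    by (simp add: sum.distrib)
  thus ?thesis using not_dvd_imp_multiplicity_0 by force
qed

text \<open>One term of the binomial expansion. It is applied with a : b = k : (n - k), where this
  term is the largest one and little is lost.\<close>

lemma choose_mult_power_le:
  fixes a b n k :: nat
  assumes "k \<le> n"
  shows "(n choose k) * a ^ k * b ^ (n - k) \<le> (a + b) ^ n"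
  using binomial[of a b n] assms member_le_sum[of k "{..n}" "\<lambda>k. (n choose k) * a ^ k * b ^ (n - k)"] by simp

text \<open>The weights 1:1, 2:1 and 6:1 bound the three factors; together they give 2^42 * 3^21 *
  7^7 / (2^14 * 6^6) for each unit of \<open>m\<close>.\<close>

lemma multinom42_le: "multinom42 m \<le> (2 ^ 22 * 3 ^ 15 * 7 ^ 7) ^ m"
proof -
  have 1: "(42 * m choose 21 * m) \<le> 2 ^ (42 * m)"
    using choose_mult_power_le[of "21 * m" "42 * m" 1 1] by (simp add: numeral_2_eq_2)
  have 2: "(21 * m choose 14 * m) * 2 ^ (14 * m) \<le> 3 ^ (21 * m)"
    using choose_mult_power_le[of "14 * m" "21 * m" 2 1] by (simp add: numeral_3_eq_3)
  have 3: "(7 * m choose 6 * m) * 6 ^ (6 * m) \<le> 7 ^ (7 * m)"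
    using choose_mult_power_le[of "6 * m" "7 * m" 6 1] by simp
  have "multinom42 m * (2 ^ (14 * m) * 6 ^ (6 * m))
      = (42 * m choose 21 * m) * ((21 * m choose 14 * m) * 2 ^ (14 * m))
        * ((7 * m choose 6 * m) * 6 ^ (6 * m))"
    unfolding multinom42_def by (simp add: mult_ac)
  also have "\<dots> \<le> 2 ^ (42 * m) * 3 ^ (21 * m) * 7 ^ (7 * m)"
    using 1 2 3 by (intro mult_mono) auto
  also have "\<dots> = (2 ^ 22 * 3 ^ 15 * 7 ^ 7) ^ m * (2 ^ (14 * m) * 6 ^ (6 * m))"
    unfolding power_mult power_mult_distrib[symmetric] by simp
  finally show ?thesis by simp
qed

lemma prod_primes_dvd:
  fixes n :: nat
  assumes "finite P" "\<And>p. p \<in> P \<Longrightarrow> prime p" "\<And>p. p \<in> P \<Longrightarrow> p dvd n"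
  shows "\<Prod>P dvd n"
  using assms
proof (induction P rule: finite_induct)
  case (insert p P)
  have "coprime p (\<Prod>P)" using insert by (intro prod_coprime_right) (metis insert_iff primes_coprime)
  thus ?case using insert by (auto intro: divides_mult)
qed simp

lemma theta_diff_le:
  "theta (42 * m) - theta m \<le> real m * (22 * ln 2 + 15 * ln 3 + 7 * ln 7)"
proof -
  let ?P = "{p. prime p \<and> m < p \<and> p \<le> 42 * m}"
  have fin: "finite ?P" by (rule finite_subset[of _ "{..42 * m}"]) auto
  have "\<Prod>?P dvd multinom42 m"
    by (rule prod_primes_dvd[OF fin]) (use prime_dvd_multinom42 in auto)
  hence "\<Prod>?P \<le> multinom42 m" using multinom42_pos by (rule dvd_imp_le)
  also note multinom42_le
  finally have "real (\<Prod>?P) \<le> real ((2 ^ 22 * 3 ^ 15 * 7 ^ 7) ^ m)" by (rule of_nat_mono)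
  hence "ln (real (\<Prod>?P)) \<le> ln (real ((2 ^ 22 * 3 ^ 15 * 7 ^ 7) ^ m))"
    by (subst ln_le_cancel_iff) (auto intro!: prod_pos dest: prime_gt_0_nat)
  also have "\<dots> = real m * (22 * ln 2 + 15 * ln 3 + 7 * ln 7)"
    unfolding of_nat_power of_nat_mult of_nat_numeral by (simp only: ln_realpow ln_mult) simp
  also have "ln (real (\<Prod>?P)) = (\<Sum>p\<in>?P. ln (real p))"
    unfolding of_nat_prod using fin by (intro ln_prod) (auto intro: prime_gt_0_nat)
  also have "\<dots> = theta (42 * m) - theta m"
  proof -
    have "{p. prime p \<and> p \<le> 42 * m} = {p. prime p \<and> p \<le> m} \<union> ?P" by auto
    hence "theta (42 * m) = theta m + (\<Sum>p\<in>?P. ln (real p))"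
      unfolding theta_def by (simp add: sum.union_disjoint fin disjoint_iff)
    thus ?thesis by simp
  qed
  finally show ?thesis .
qed

lemma ln_2_bounds: "ln 2 \<in> {0.693147..0.693148::real}"
  using ln_approx_bounds[of 2 6] by (simp add: eval_nat_numeral)
lemma ln_3_bounds: "ln 3 \<in> {1.098612..1.098613::real}"
  using ln_approx_bounds[of 3 11] by (simp add: eval_nat_numeral)
lemma ln_7_bounds: "ln 7 \<in> {1.945909..1.945911::real}"
  using ln_approx_bounds[of 7 30] by (simp add: eval_nat_numeral)

text \<open>The slope comes from \<open>(22 ln 2 + 15 ln 3 + 7 ln 7) / 41 < 1.1062\<close>.\<close>

lemma theta_le:
  assumes "1 \<le> x"
  shows "theta x \<le> (5531 / 5000) * real x + 15 * ln (real x) + 46"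
  using assms
proof (induction x rule: less_induct)
  case (less x)
  \<comment> \<open>This is x/42 rounded up. The base case \<open>m = 1\<close> accounts for the
    constant 46.\<close>
  define m where "m = (x + 41) div 42"
  define S where "S = 22 * ln 2 + 15 * ln 3 + 7 * ln (7 :: real)"
  have S: "S \<le> (907 / 20)" using ln_2_bounds ln_3_bounds ln_7_bounds unfolding S_def by simp
  have m: "x \<le> 42 * m" "42 * m \<le> x + 41" "1 \<le> m" using less.prems unfolding m_def by linarith+
  have le: "theta x \<le> theta m + S * real m"
    using theta_mono[OF m(1)] theta_diff_le[of m] by (simp add: S_def mult.commute)
  show ?case
  proof (cases "m = 1")
    case True
    have "theta 1 = 0" by (auto simp: theta_def intro!: sum.neutral dest: prime_gt_1_nat)
    hence "theta x \<le> (907 / 20)" using le S True by simp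
    moreover have "0 \<le> ln (real x)" "0 \<le> (5531 / 5000) * real x" using less.prems by simp_all
    ultimately show ?thesis by linarith
  next
    case False
    with m have mx: "21 * m \<le> x" "m < x" by linarith+
    \<comment> \<open>The logarithm drops by ln 21 > 3.04 in each descent; 15 * 3.04 = 45.6 pays for
      the rounding, which costs at most 41 * 5531/5000 < 45.4.\<close>
    have "ln (real (21 * m)) \<le> ln (real x)" using mx m by (subst ln_le_cancel_iff) linarith+
    moreover have "ln (real (21 * m)) = ln 3 + ln 7 + ln (real m)"
      using m ln_mult[of 3 7] by (simp add: ln_mult)
    ultimately have lnm: "ln (real m) + 3.04 \<le> ln (real x)"
      using ln_3_bounds ln_7_bounds by simp
    have "theta m \<le> (5531 / 5000) * real m + 15 * ln (real m) + 46"
      by (rule less.IH) (use mx m in auto)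
    moreover have "S * real m \<le> (907 / 20) * real m" using S by (rule mult_right_mono) simp
    moreover have "real (42 * m) \<le> real (x + 41)" using m(2) by (rule of_nat_mono)
    ultimately show ?thesis using le lnm by simp
  qed
qed

section \<open>Products of consecutive integers\<close>

definition prime_count :: "nat \<Rightarrow> nat" where
  "prime_count x = card {p. prime p \<and> p \<le> x}"

text \<open>In truncated subtraction \<open>(i - j) + (j - i)\<close> is the distance of i and j.
  The distances are 1, ..., i on the left of i and 1, ..., k - 1 - i on its right.\<close>

lemma prod_dist_eq:
  fixes i k :: nat
  assumes "i < k"
  shows "(\<Prod>j\<in>{..<k} - {i}. (i - j) + (j - i)) = fact i * fact (k - 1 - i)"
proof -
  have "{..<k} - {i} = {..<i} \<union> {i<..<k}" using assms by auto
  hence "(\<Prod>j\<in>{..<k} - {i}. (i - j) + (j - i))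
      = (\<Prod>j<i. (i - j) + (j - i)) * (\<Prod>j\<in>{i<..<k}. (i - j) + (j - i))"
    by (simp add: prod.union_disjoint disjoint_iff)
  also have "(\<Prod>j<i. (i - j) + (j - i)) = \<Prod>{1..i}"
    by (rule prod.reindex_bij_witness[of _ "\<lambda>l. i - l" "\<lambda>j. i - j"]) auto
  also have "(\<Prod>j\<in>{i<..<k}. (i - j) + (j - i)) = \<Prod>{1..k - 1 - i}"
    by (rule prod.reindex_bij_witness[of _ "\<lambda>l. i + l" "\<lambda>j. j - i"]) auto
  finally show ?thesis by (simp add: fact_prod)
qed

text \<open>Omitting a term \<open>n - i\<close> of maximal \<open>p\<close>-adic valuation, the valuation of every other term
  \<open>n - j\<close> is at most that of \<open>i - j\<close>.\<close>

lemma multiplicity_prod_consecutive: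
  fixes p n k :: nat
  assumes p: "prime p" and k: "1 \<le> k" "k \<le> n"
  obtains i where "i < k"
    "multiplicity p (\<Prod>j\<in>{..<k} - {i}. n - j) \<le> multiplicity p (fact (k - 1))"
proof -
  obtain i where i: "i < k" "\<And>j. j < k \<Longrightarrow> multiplicity p (n - j) \<le> multiplicity p (n - i)"
  proof -
    let ?A = "(\<lambda>j. multiplicity p (n - j)) ` {..<k}"
    have "Max ?A \<in> ?A" using k by (intro Max_in) (auto simp: lessThan_empty_iff bot_nat_def)
    then obtain i where "i < k" "multiplicity p (n - i) = Max ?A" by auto
    thus thesis using that[of i] by simp
  qed
  have "multiplicity p (n - j) \<le> multiplicity p ((i - j) + (j - i))" if "j \<in> {..<k} - {i}" for j
  proof (rule multiplicity_geI)
    let ?q = "p ^ multiplicity p (n - j)"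
    have "?q dvd n - j" "?q dvd n - i"
      using i(2)[of j] that by (auto intro: multiplicity_dvd')
    hence "?q dvd (n - j) - (n - i)" "?q dvd (n - i) - (n - j)" by (auto intro!: dvd_diff_nat simp del: diff_diff_left)
    moreover have "(n - j) - (n - i) = i - j" "(n - i) - (n - j) = j - i"
      using that i k by auto
    ultimately show "?q dvd (i - j) + (j - i)" by simp
  qed (use that p in auto)
  hence "(\<Sum>j\<in>{..<k} - {i}. multiplicity p (n - j))
      \<le> (\<Sum>j\<in>{..<k} - {i}. multiplicity p ((i - j) + (j - i)))"
    by (rule sum_mono)
  also have "\<dots> = multiplicity p (\<Prod>j\<in>{..<k} - {i}. (i - j) + (j - i))"
    using p by (intro prime_elem_multiplicity_prod_distrib[symmetric]) auto
  also have "\<dots> \<le> multiplicity p (fact (k - 1))"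
  proof (rule dvd_imp_multiplicity_le)
    have "fact i * fact (k - 1 - i) dvd (fact (i + (k - 1 - i)) :: nat)"
      by (rule fact_fact_dvd_fact)
    thus "(\<Prod>j\<in>{..<k} - {i}. (i - j) + (j - i)) dvd fact (k - 1)"
      using i by (simp add: prod_dist_eq)
  qed simp
  also have "(\<Sum>j\<in>{..<k} - {i}. multiplicity p (n - j)) = multiplicity p (\<Prod>j\<in>{..<k} - {i}. n - j)"
    using p k by (intro prime_elem_multiplicity_prod_distrib[symmetric]) auto
  finally show thesis using that i(1) by blast
qed

text \<open>One index \<open>f p\<close> is discarded for every prime \<open>p \<le> b\<close>, so
  at least \<open>k - prime_count b\<close> factors remain, each at least \<open>n - k + 1\<close>.
  Their product divides \<open>(k - 1)!\<close>: for \<open>p \<le> b\<close> by the choice of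
  \<open>f p\<close>, and larger primes do not occur in it.\<close>

lemma smooth_consecutive_power_le:
  fixes n k b :: nat
  assumes k: "1 \<le> k" "k \<le> n"
    and smooth: "\<And>i p. i < k \<Longrightarrow> prime p \<Longrightarrow> p dvd n - i \<Longrightarrow> p \<le> b"
  shows "(n - k + 1) ^ (k - prime_count b) \<le> fact (k - 1)"
proof -
  have "\<exists>i<k. multiplicity p (\<Prod>j\<in>{..<k} - {i}. n - j) \<le> multiplicity p (fact (k - 1))"
    if "prime p" for p :: nat
    using multiplicity_prod_consecutive[OF that k] by metis
  then obtain f where f: "\<And>p. prime p \<Longrightarrow>
      multiplicity p (\<Prod>j\<in>{..<k} - {f p}. n - j) \<le> multiplicity p (fact (k - 1))"
    by metis
  define S where "S = {..<k} - f ` {p. prime p \<and> p \<le> b}"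
  have S: "finite S" "S \<subseteq> {..<k}" by (auto simp: S_def)
  have "(\<Prod>j\<in>S. n - j) dvd fact (k - 1)"
  proof (rule multiplicity_le_imp_dvd)
    fix p :: nat assume p: "prime p"
    show "multiplicity p (\<Prod>j\<in>S. n - j) \<le> multiplicity p (fact (k - 1))"
    proof (cases "p \<le> b")
      case True
      have "(\<Prod>j\<in>S. n - j) dvd (\<Prod>j\<in>{..<k} - {f p}. n - j)"
        using True p by (intro prod_dvd_prod_subset) (auto simp: S_def)
      moreover have "(\<Prod>j\<in>{..<k} - {f p}. n - j) \<noteq> 0" using k by auto
      ultimately show ?thesis using f[OF p] dvd_imp_multiplicity_le order.trans by metis
    next
      case False
      hence "\<not> p dvd n - j" if "j \<in> S" for j using smooth[of j p] that S p by auto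
      hence "\<not> p dvd (\<Prod>j\<in>S. n - j)" using S(1) p by (simp add: prime_dvd_prod_iff)
      thus ?thesis by (simp add: not_dvd_imp_multiplicity_0)
    qed
  qed (use S k in auto)
  hence "(\<Prod>j\<in>S. n - j) \<le> fact (k - 1)" by (rule dvd_imp_le) simp
  moreover have "(n - k + 1) ^ card S \<le> (\<Prod>j\<in>S. n - j)"
  proof -
    have "(\<Prod>j\<in>S. n - k + 1) \<le> (\<Prod>j\<in>S. n - j)" using S k by (intro prod_mono) auto
    thus ?thesis by simp
  qed
  moreover have "k - prime_count b \<le> card S"
  proof -
    have "card (f ` {p. prime p \<and> p \<le> b}) \<le> prime_count b"
      unfolding prime_count_def by (rule card_image_le) simp
    thus ?thesis using diff_card_le_card_Diff[of "f ` {p. prime p \<and> p \<le> b}" "{..<k}"]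
      by (simp add: S_def)
  qed
  hence "(n - k + 1) ^ (k - prime_count b) \<le> (n - k + 1) ^ card S"
    by (intro power_increasing) auto
  ultimately show ?thesis by linarith
qed

section \<open>Prime factors of binomial coefficients\<close>

lemma prod_consecutive_eq:
  fixes n k :: nat
  shows "(\<Prod>j<k. n - j) = fact k * (n choose k)"
proof (induction k)
  case (Suc k)
  have "Suc k * (n choose Suc k) = (n - k) * (n choose k)"
    by (simp only: binomial_absorption binomial_absorb_comp)
  hence "fact k * (n choose k) * (n - k) = fact k * (Suc k * (n choose Suc k))"
    by (simp add: mult_ac)
  also have "\<dots> = fact (Suc k) * (n choose Suc k)"
    by (simp only: fact_Suc of_nat_id mult_ac)
  finally show ?case using Suc by simp
qed simp

text \<open>In \<open>fact k * (n choose k) = (n - i) * ...\<close> the remaining factors have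
  valuation at most that of \<open>fact (k - 1)\<close>, so \<open>n - i\<close> must carry all of
  the valuation of the binomial coefficient.\<close>

lemma prime_power_multiplicity_binomial_le:
  fixes p n k :: nat
  assumes p: "prime p" and k: "1 \<le> k" "k \<le> n"
  shows "p ^ multiplicity p (n choose k) \<le> n"
proof -
  obtain i where i: "i < k"
    "multiplicity p (\<Prod>j\<in>{..<k} - {i}. n - j) \<le> multiplicity p (fact (k - 1))"
    using multiplicity_prod_consecutive[OF assms] .
  have "(\<Prod>j<k. n - j) = (n - i) * (\<Prod>j\<in>{..<k} - {i}. n - j)"
    using i by (intro prod.remove) auto
  hence "fact k * (n choose k) = (n - i) * (\<Prod>j\<in>{..<k} - {i}. n - j)"
    by (simp add: prod_consecutive_eq)
  hence "multiplicity p (fact k * (n choose k))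
      = multiplicity p ((n - i) * (\<Prod>j\<in>{..<k} - {i}. n - j))" by simp
  moreover have "multiplicity p (fact k * (n choose k))
      = multiplicity p (fact k) + multiplicity p (n choose k)"
    using p k by (subst prime_elem_multiplicity_mult_distrib) auto
  moreover have "multiplicity p ((n - i) * (\<Prod>j\<in>{..<k} - {i}. n - j))
      = multiplicity p (n - i) + multiplicity p (\<Prod>j\<in>{..<k} - {i}. n - j)"
    using p k i(1) by (subst prime_elem_multiplicity_mult_distrib) auto
  moreover have "multiplicity p (fact (k - 1)) \<le> multiplicity p (fact k)"
    by (intro dvd_imp_multiplicity_le fact_dvd) auto
  ultimately have "multiplicity p (n choose k) \<le> multiplicity p (n - i)" using i(2) by linarith
  hence "p ^ multiplicity p (n choose k) dvd n - i" by (rule multiplicity_dvd')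
  hence "p ^ multiplicity p (n choose k) \<le> n - i" using i(1) k by (intro dvd_imp_le) auto
  thus ?thesis by simp
qed

lemma ln_eq_sum_prime_factors:
  fixes n :: nat
  assumes "0 < n"
  shows "ln (real n) = (\<Sum>p\<in>prime_factors n. real (multiplicity p n) * ln (real p))"
proof -
  have "n = (\<Prod>p\<in>prime_factors n. p ^ multiplicity p n)"
    using assms by (rule prime_factorization_nat)
  hence "ln (real n) = ln (real (\<Prod>p\<in>prime_factors n. p ^ multiplicity p n))" by simp
  also have "\<dots> = (\<Sum>p\<in>prime_factors n. ln (real (p ^ multiplicity p n)))"
    unfolding of_nat_prod by (intro ln_prod) (auto intro!: prime_gt_0_nat)
  also have "\<dots> = (\<Sum>p\<in>prime_factors n. real (multiplicity p n) * ln (real p))"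
    by (intro sum.cong) (auto simp: ln_realpow prime_gt_0_nat)
  finally show ?thesis .
qed

lemma multiplicity_binomial_ln_le:
  fixes p n k :: nat
  assumes "prime p" "1 \<le> k" "k \<le> n"
  shows "real (multiplicity p (n choose k)) * ln (real p) \<le> ln (real n)"
proof -
  have p0: "real p > 0" using prime_gt_0_nat[OF assms(1)] by simp
  have "real (p ^ multiplicity p (n choose k)) \<le> real n"
    using prime_power_multiplicity_binomial_le[OF assms] by (rule of_nat_mono)
  hence "ln (real p ^ multiplicity p (n choose k)) \<le> ln (real n)"
    using p0 assms by (subst ln_le_cancel_iff) auto
  thus ?thesis using p0 by (simp add: ln_realpow)
qed

lemma ln_binomial_le_prime_count:
  fixes n k b :: nat
  assumes k: "1 \<le> k" "k \<le> n" and smooth: "\<And>p. prime p \<Longrightarrow> p dvd n choose k \<Longrightarrow> p \<le> b"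
  shows "ln (real (n choose k)) \<le> real (prime_count b) * ln (real n)"
proof -
  have "ln (real (n choose k)) \<le> (\<Sum>p\<in>prime_factors (n choose k). ln (real n))"
    unfolding ln_eq_sum_prime_factors[of "n choose k", simplified, OF k(2)]
    using k by (intro sum_mono multiplicity_binomial_ln_le) auto
  also have "\<dots> = real (card (prime_factors (n choose k))) * ln (real n)" by simp
  also have "\<dots> \<le> real (prime_count b) * ln (real n)"
    unfolding prime_count_def using k smooth
    by (intro mult_right_mono of_nat_mono card_mono) auto
  finally show ?thesis .
qed

text \<open>A prime above \<open>s\<close>, that is above the square root of n, occurs at most once
  and is paid for by \<open>theta b\<close>; each of the others costs at most
  \<open>ln n\<close>.\<close>

lemma ln_binomial_le_theta:
  fixes n k b s :: nat
  assumes k: "1 \<le> k" "k \<le> n" and smooth: "\<And>p. prime p \<Longrightarrow> p dvd n choose k \<Longrightarrow> p \<le> b"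
    and s: "n < (Suc s)\<^sup>2"
  shows "ln (real (n choose k)) \<le> theta b + real (prime_count s) * ln (real n)"
proof -
  let ?P = "prime_factors (n choose k)"
  have le: "real (multiplicity p (n choose k)) * ln (real p)
      \<le> ln (real p) + (if p \<le> s then ln (real n) else 0)" if "p \<in> ?P" for p
  proof (cases "p \<le> s")
    case True
    have "0 \<le> ln (real p)" using that by (auto dest!: in_prime_factors_imp_prime prime_ge_1_nat)
    thus ?thesis using True multiplicity_binomial_ln_le[of p k n] that k by fastforce
  next
    case False
    have p: "prime p" using that by auto
    have "multiplicity p (n choose k) \<le> 1"
    proof (rule ccontr)
      assume "\<not> ?thesis"
      hence "p ^ 2 \<le> p ^ multiplicity p (n choose k)"
        using prime_ge_1_nat[OF p] by (intro power_increasing) auto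
      also have "\<dots> \<le> n" using prime_power_multiplicity_binomial_le[OF p k] .
      finally have "p\<^sup>2 < (Suc s)\<^sup>2" using s by simp
      thus False using False by (auto dest: power_less_imp_less_base)
    qed
    hence "real (multiplicity p (n choose k)) * ln (real p) \<le> 1 * ln (real p)"
      using prime_ge_1_nat[OF p] by (intro mult_right_mono) auto
    thus ?thesis using False by simp
  qed
  have "ln (real (n choose k)) \<le> (\<Sum>p\<in>?P. ln (real p) + (if p \<le> s then ln (real n) else 0))"
    unfolding ln_eq_sum_prime_factors[of "n choose k", simplified, OF k(2)]
    by (rule sum_mono) (rule le)
  also have "\<dots> = (\<Sum>p\<in>?P. ln (real p)) + real (card (?P \<inter> {p. p \<le> s})) * ln (real n)"
    by (simp add: sum.distrib sum.If_cases)
  also have "(\<Sum>p\<in>?P. ln (real p)) \<le> theta b"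
    unfolding theta_def using smooth by (intro sum_mono2) (auto dest: prime_ge_1_nat)
  also have "real (card (?P \<inter> {p. p \<le> s})) * ln (real n) \<le> real (prime_count s) * ln (real n)"
    unfolding prime_count_def using k by (intro mult_right_mono of_nat_mono card_mono) auto
  finally show ?thesis by simp
qed

section \<open>Tables of primes\<close>

text \<open>The tables are lists of integers because numerals of type \<^typ>\<open>nat\<close> are evaluated in
  unary.\<close>

definition primes_512 :: "int list" where
  "primes_512 =
    [2, 3, 5, 7, 11, 13, 17, 19, 23, 29, 31, 37, 41, 43, 47, 53, 59, 61, 67, 71, 73, 79, 83,
    89, 97, 101, 103, 107, 109, 113, 127, 131, 137, 139, 149, 151, 157, 163, 167, 173, 179,
    181, 191, 193, 197, 199, 211, 223, 227, 229, 233, 239, 241, 251, 257, 263, 269, 271,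
    277, 281, 283, 293, 307, 311, 313, 317, 331, 337, 347, 349, 353, 359, 367, 373, 379,
    383, 389, 397, 401, 409, 419, 421, 431, 433, 439, 443, 449, 457, 461, 463, 467, 479,
    487, 491, 499, 503, 509]"

text \<open>Beyond 2, 3 and 5 only 18 * 8 candidates 30a + r with r coprime to 30 remain. Trial
  division up to 19 decides them, since 512 < 23^2.\<close>

lemma prime_less_512_imp_mem:
  fixes p :: nat
  assumes "prime p" "p < 512"
  shows "int p \<in> set primes_512"
proof (cases "p = 2 \<or> p = 3 \<or> p = 5")
  case False
  have dvd: "q = p" if "q dvd p" "prime q" for q :: nat
    using that assms(1) primes_dvd_imp_eq by blast
  have nd: "\<not> 2 dvd p" "\<not> 3 dvd p" "\<not> 5 dvd p"
    using dvd[of 2] dvd[of 3] dvd[of 5] False by auto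
  have "p > 1" using assms(1) by (rule prime_gt_1_nat)
  moreover have "\<not> 7 dvd p \<or> p = 7" "\<not> 11 dvd p \<or> p = 11" "\<not> 13 dvd p \<or> p = 13"
    "\<not> 17 dvd p \<or> p = 17" "\<not> 19 dvd p \<or> p = 19"
    using dvd[of 7] dvd[of 11] dvd[of 13] dvd[of 17] dvd[of 19] by auto
  ultimately have "p \<noteq> 1" "\<forall>q\<in>set [7, 11, 13, 17, 19]. q dvd p \<longrightarrow> p = q" by auto
  define a r where "a = p div 30" and "r = p mod 30"
  have p: "p = 30 * a + r" by (simp add: a_def r_def)
  have "a < 18" using assms(2) by (auto simp: a_def)
  have "r < 30" by (simp add: r_def)
  have "r \<in> {1, 7, 11, 13, 17, 19, 23, 29}"
  proof -
    have "\<not> 2 dvd r" "\<not> 3 dvd r" "\<not> 5 dvd r"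
      using nd unfolding r_def by (simp_all add: dvd_mod_iff)
    thus ?thesis using \<open>r < 30\<close> unfolding insert_iff empty_iff by presburger
  qed
  moreover have "a \<in> {0, 1, 2, 3, 4, 5, 6, 7, 8, 9, 10, 11, 12, 13, 14, 15, 16, 17}" using \<open>a < 18\<close>
    unfolding insert_iff empty_iff by presburger
  ultimately show ?thesis using \<open>p \<noteq> 1\<close> \<open>\<forall>q\<in>set [7, 11, 13, 17, 19]. q dvd p \<longrightarrow> p = q\<close> assms(2) unfolding p
    by (elim insertE emptyE) (simp_all add: primes_512_def)
qed (auto simp: primes_512_def)

primrec trial_division :: "int list \<Rightarrow> int \<Rightarrow> int list \<Rightarrow> bool" where
  "trial_division ds b [] = True"
| "trial_division ds b (p # ps) =
    (1 < p \<and> p < b\<^sup>2 \<and> list_all (\<lambda>d. d dvd p \<longrightarrow> d = p) ds \<and> trial_division ds b ps)"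

text \<open>A composite number below \<open>b\<^sup>2\<close> has a prime factor below
  \<open>b\<close>; this factor lies in \<open>ds\<close>, and the check would make it equal to the
  number itself.\<close>

lemma trial_division_imp_prime:
  assumes "trial_division ds (int b) ps" and ds: "\<And>q::nat. prime q \<Longrightarrow> q < b \<Longrightarrow> int q \<in> set ds"
    and "p \<in> set ps"
  shows "prime p"
  using assms(1, 3)
proof (induction ps)
  case (Cons p' ps)
  show ?case
  proof (cases "p = p'")
    case True
    with Cons.prems have p: "1 < p" "p < (int b)\<^sup>2" "list_all (\<lambda>d. d dvd p \<longrightarrow> d = p) ds" by auto
    define P where "P = nat p"
    have pP: "p = int P" using p by (simp add: P_def)
    have "int P < int (b\<^sup>2)" using p by (simp add: pP)
    hence P: "1 < P" "P < b\<^sup>2" using p pP by linarith+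
    have "prime P"
    proof (rule ccontr)
      assume "\<not> prime P"
      then obtain m where "m dvd P" "m \<noteq> 1" "m \<noteq> P" using P(1) by (auto simp: prime_nat_iff)
      then obtain c where c: "P = m * c" by blast
      define d where "d = min m c"
      have "d * d \<le> P" unfolding d_def c by (cases "m \<le> c") auto
      have "d \<noteq> 1" using c \<open>m \<noteq> 1\<close> \<open>m \<noteq> P\<close> by (auto simp: d_def min_def)
      then obtain q where "prime q" "q dvd d" using prime_factor_nat by blast
      moreover have "d dvd P" by (auto simp: d_def c min_def)
      moreover have "0 < d" using c P(1) by (cases m; cases c) (auto simp: d_def)
      ultimately have q: "prime q" "q dvd P" "q * q \<le> P"
        using \<open>d * d \<le> P\<close> mult_le_mono[of q d q d] dvd_imp_le[of q d] by (auto intro: dvd_trans)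
      hence "q\<^sup>2 < b\<^sup>2" using P(2) by (simp add: power2_eq_square)
      hence "q < b" by (rule power_less_imp_less_base) simp
      with ds q(1) have "int q \<in> set ds" by blast
      hence "q = P" using p(3) q(2) by (auto simp: list_all_iff pP)
      thus False using q(1) \<open>\<not> prime P\<close> by simp
    qed
    thus ?thesis by (simp add: pP)
  qed (use Cons in auto)
qed simp

lemma prime_count_Suc: "prime_count (Suc x) = prime_count x + (if prime (Suc x) then 1 else 0)"
proof -
  have "{p. prime p \<and> p \<le> Suc x} = {p. prime p \<and> p \<le> x} \<union> (if prime (Suc x) then {Suc x} else {})"
    by (auto simp: le_Suc_eq)
  thus ?thesis by (auto simp: prime_count_def card_insert_if)
qed

lemma prime_count_double_Suc:
  assumes "1 \<le> k"
  shows "prime_count (2 * Suc k) = prime_count (2 * k) + (if prime (2 * k + 1) then 1 else 0)"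
proof -
  have "\<not> prime (2 * k + 2)" using assms by (auto dest: prime_odd_nat)
  thus ?thesis by (simp add: prime_count_Suc)
qed

lemma prime_count_le_length:
  assumes "x < 512"
  shows "prime_count x \<le> length (filter (\<lambda>p. p \<le> int x) primes_512)"
proof -
  have "int ` {p. prime p \<and> p \<le> x} \<subseteq> set (filter (\<lambda>p. p \<le> int x) primes_512)"
    using assms by (auto intro: prime_less_512_imp_mem)
  hence "card (int ` {p. prime p \<and> p \<le> x}) \<le> card (set (filter (\<lambda>p. p \<le> int x) primes_512))"
    by (intro card_mono) auto
  also have "\<dots> \<le> length (filter (\<lambda>p. p \<le> int x) primes_512)" by (rule card_length)
  finally show ?thesis by (simp add: prime_count_def card_image)
qed

lemma trial_division_512:
  assumes "b \<le> 512" "trial_division (filter (\<lambda>d. d < int b) primes_512) (int b) ps" "p \<in> set ps"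
  shows "prime p"
  using assms by (intro trial_division_imp_prime[OF assms(2) _ assms(3)]) (auto intro: prime_less_512_imp_mem)

text \<open>Gaps of at most \<open>14\<close> and \<open>34\<close> exclude runs of \<open>14\<close> and \<open>34\<close> composite
  numbers below \<open>500\<close> and \<open>1300\<close>; longer runs of length \<open>k\<close> then satisfy \<open>20k < n\<close>.\<close>

primrec increasing_gaps :: "int \<Rightarrow> int list \<Rightarrow> bool" where
  "increasing_gaps q [] = True"
| "increasing_gaps q (q' # qs) = (q < q' \<and> q' \<le> q + (if q < 500 then 14 else if q < 1300 then 34 else q div 20)
     \<and> increasing_gaps q' qs)"

text \<open>The chains skip primes as far as \<open>increasing_gaps\<close> permits. They are split
  so that trial division by the primes below 23, 83, 211 and 512 is enough for the respective
  entries; the last entry 262139 lies just below 2^18 = 512^2.\<close>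

definition prime_chain_1 :: "int list" where
  "prime_chain_1 =
    [23, 37, 47, 61, 73, 83, 97, 109, 113, 127, 139, 151, 163, 173, 181, 193, 199, 211, 223,
    233, 241, 251, 263, 277, 283, 293, 307, 317, 331, 337, 349, 359, 373, 383, 397, 409, 421,
    433, 443, 457, 467, 479, 491, 503, 523]"

definition prime_chain_2 :: "int list" where
  "prime_chain_2 =
    [557, 587, 619, 653, 683, 709, 743, 773, 797, 829, 863, 887, 919, 953, 983, 1013, 1039,
    1069, 1103, 1129, 1163, 1193, 1223, 1249, 1283, 1307, 1367, 1433, 1499, 1571, 1637, 1709,
    1789, 1877, 1951, 2039, 2137, 2243, 2351, 2467, 2579, 2707, 2837, 2971, 3119, 3271, 3433,
    3593, 3769, 3947, 4139, 4339, 4549, 4759, 4993, 5237, 5483, 5749, 6029, 6329, 6637]"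

definition prime_chain_3 :: "int list" where
  "prime_chain_3 =
    [6967, 7309, 7673, 8053, 8447, 8867, 9293, 9749, 10223, 10733, 11261, 11821, 12409, 13009,
    13649, 14327, 15031, 15773, 16561, 17389, 18257, 19163, 20117, 21121, 22171, 23279, 24439,
    25657, 26927, 28229, 29633, 31091, 32633, 34261, 35969, 37747, 39631, 41611, 43691]"

definition prime_chain_4 :: "int list" where
  "prime_chain_4 =
    [45869, 48157, 50551, 53077, 55721, 58481, 61403, 64453, 67651, 71023, 74573, 78301, 82207,
    86311, 90619, 95143, 99881, 104869, 110083, 115571, 121349, 127403, 133769, 140453, 147457,
    154823, 162563, 170689, 179213, 188171, 197573, 207443, 217793, 228677, 240109, 252101,
    262139]"

lemma prime_chain_1: "p \<in> set prime_chain_1 \<Longrightarrow> prime p"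
proof (rule trial_division_512[of 23])
  have ds: "filter (\<lambda>d. d < int 23) primes_512 =
      [2, 3, 5, 7, 11, 13, 17, 19]"
    by (simp add: primes_512_def)
  show "trial_division (filter (\<lambda>d. d < int 23) primes_512) (int 23) prime_chain_1"
    unfolding ds prime_chain_1_def of_nat_numeral by code_simp
qed auto

lemma prime_chain_2: "p \<in> set prime_chain_2 \<Longrightarrow> prime p"
proof (rule trial_division_512[of 83])
  have ds: "filter (\<lambda>d. d < int 83) primes_512 =
      [2, 3, 5, 7, 11, 13, 17, 19, 23, 29, 31, 37, 41, 43, 47, 53, 59, 61, 67, 71, 73, 79]"
    by (simp add: primes_512_def)
  show "trial_division (filter (\<lambda>d. d < int 83) primes_512) (int 83) prime_chain_2"
    unfolding ds prime_chain_2_def of_nat_numeral by code_simp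
qed auto

lemma prime_chain_3: "p \<in> set prime_chain_3 \<Longrightarrow> prime p"
proof (rule trial_division_512[of 211])
  have ds: "filter (\<lambda>d. d < int 211) primes_512 =
      [2, 3, 5, 7, 11, 13, 17, 19, 23, 29, 31, 37, 41, 43, 47, 53, 59, 61, 67, 71, 73, 79,
      83, 89, 97, 101, 103, 107, 109, 113, 127, 131, 137, 139, 149, 151, 157, 163, 167,
      173, 179, 181, 191, 193, 197, 199]"
    by (simp add: primes_512_def)
  show "trial_division (filter (\<lambda>d. d < int 211) primes_512) (int 211) prime_chain_3"
    unfolding ds prime_chain_3_def of_nat_numeral by code_simp
qed auto

lemma prime_chain_4: "p \<in> set prime_chain_4 \<Longrightarrow> prime p"
proof (rule trial_division_512[of 512])
  have ds: "filter (\<lambda>d. d < int 512) primes_512 = primes_512"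
    by (simp add: primes_512_def)
  show "trial_division (filter (\<lambda>d. d < int 512) primes_512) (int 512) prime_chain_4"
    unfolding ds prime_chain_4_def of_nat_numeral unfolding primes_512_def by code_simp
qed auto

lemma increasing_gaps_imp:
  assumes "increasing_gaps (int q) qs" "\<forall>p\<in>set qs. prime p" "q < m" "int m \<le> last (int q # qs)"
  shows "\<exists>q q'. q < m \<and> m \<le> q' \<and> prime q' \<and>
    q' \<le> q + (if q < 500 then 14 else if q < 1300 then 34 else q div 20)"
  using assms
proof (induction qs arbitrary: q)
  case (Cons q' qs)
  define r where "r = nat q'"
  have r: "q' = int r" using Cons.prems by (auto simp: r_def)
  show ?case
  proof (cases "m \<le> r")
    case True
    have "int r \<le> int (q + (if q < 500 then 14 else if q < 1300 then 34 else q div 20))"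
      using Cons.prems(1) by (auto simp: r zdiv_int split: if_splits)
    hence "r \<le> q + (if q < 500 then 14 else if q < 1300 then 34 else q div 20)" by linarith
    thus ?thesis using Cons.prems True r by (intro exI[of _ q] exI[of _ r]) auto
  next
    case False
    thus ?thesis using Cons.prems r by (intro Cons.IH[of r]) (auto split: if_splits)
  qed
qed simp

lemma ex_prime_gap:
  fixes m :: nat
  assumes "11 < m" "m \<le> 262139"
  obtains q q' where "q < m" "m \<le> q'" "prime q'"
    "q' \<le> q + (if q < 500 then 14 else if q < 1300 then 34 else q div 20)"
proof -
  let ?c = "prime_chain_1 @ prime_chain_2 @ prime_chain_3 @ prime_chain_4"
  have "increasing_gaps 11 ?c"
    unfolding prime_chain_1_def prime_chain_2_def prime_chain_3_def prime_chain_4_def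
      append_Cons append_Nil
    by code_simp
  moreover have "\<forall>p\<in>set ?c. prime p"
    using prime_chain_1 prime_chain_2 prime_chain_3 prime_chain_4 by auto
  moreover have "last (int 11 # ?c) = last prime_chain_4" by (simp add: prime_chain_4_def)
  moreover have "last prime_chain_4 = 262139" by (simp add: prime_chain_4_def)
  ultimately have "\<exists>q q'. q < m \<and> m \<le> q' \<and> prime q' \<and>
      q' \<le> q + (if q < 500 then 14 else if q < 1300 then 34 else q div 20)"
    using assms by (intro increasing_gaps_imp[of 11 ?c m]) simp_all
  thus thesis using that by blast
qed

lemma primes_512_prime:
  assumes "p \<in> set primes_512"
  shows "prime p"
proof (rule trial_division_imp_prime[OF _ _ assms])
  show "trial_division [2, 3, 5, 7, 11, 13, 17, 19] (int 23) primes_512"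
    unfolding primes_512_def of_nat_numeral by code_simp
  fix q :: nat assume "prime q" "q < 23"
  thus "int q \<in> set [2, 3, 5, 7, 11, 13, 17, 19]"
    using prime_less_512_imp_mem[of q] by (auto simp: primes_512_def)
qed

section \<open>Prime counts\<close>

text \<open>\<open>i\<close> is the number of primes before the current one; \<open>4pi(x) \<le> x\<close> fails just below
  \<open>120\<close>, hence the maximum.\<close>

primrec quarter_check :: "int \<Rightarrow> int list \<Rightarrow> bool" where
  "quarter_check i [] = True"
| "quarter_check i (p # ps) =
    (4 * (i + 1) \<le> p + 13 \<and> 4 * (i + 1) \<le> max p 120 \<and> quarter_check (i + 1) ps)"

text \<open>Between two entries of the list the count is constant while the bounds do not decrease,
  so checking at the entries suffices. The assumptions on \<open>i\<close> cover an \<open>x\<close>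
  below the first entry.\<close>

lemma quarter_check_imp:
  assumes "quarter_check i ps" "sorted ps" "4 * i \<le> x + 13" "4 * i \<le> max x 120"
  shows "4 * (i + int (length (filter (\<lambda>p. p \<le> x) ps))) \<le> x + 13"
    and "4 * (i + int (length (filter (\<lambda>p. p \<le> x) ps))) \<le> max x 120"
proof -
  have "4 * (i + int (length (filter (\<lambda>p. p \<le> x) ps))) \<le> x + 13 \<and>
    4 * (i + int (length (filter (\<lambda>p. p \<le> x) ps))) \<le> max x 120"
    using assms
  proof (induction ps arbitrary: i)
    case (Cons p ps)
    show ?case
    proof (cases "p \<le> x")
      case True
      hence "4 * (i + 1) \<le> x + 13 \<and> 4 * (i + 1) \<le> max x 120" using Cons.prems by auto
      thus ?thesis using Cons.IH[of "i + 1"] Cons.prems True by (simp add: algebra_simps)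
    next
      case False
      hence "\<forall>p'\<in>set (p # ps). \<not> p' \<le> x" using Cons.prems(2) by auto
      hence "filter (\<lambda>p. p \<le> x) (p # ps) = []" by (simp only: filter_empty_conv)
      thus ?thesis using Cons.prems by (simp del: filter.simps)
    qed
  qed simp
  thus "4 * (i + int (length (filter (\<lambda>p. p \<le> x) ps))) \<le> x + 13"
    and "4 * (i + int (length (filter (\<lambda>p. p \<le> x) ps))) \<le> max x 120" by blast+
qed

lemma sorted_primes_512: "sorted primes_512"
  unfolding primes_512_def by code_simp

lemma prime_count_quarter_base:
  assumes "x < 512"
  shows "4 * prime_count x \<le> x + 13" "4 * prime_count x \<le> max x 120"
proof -
  have "quarter_check 0 primes_512" unfolding primes_512_def by code_simp
  moreover define l where "l = length (filter (\<lambda>p. p \<le> int x) primes_512)"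
  moreover have "4 * 0 \<le> int x + 13" "4 * 0 \<le> max (int x) 120" by auto
  ultimately have "4 * (0 + int l) \<le> int x + 13" "4 * (0 + int l) \<le> max (int x) 120"
    using quarter_check_imp[OF _ sorted_primes_512] by blast+
  moreover have "prime_count x \<le> l" unfolding l_def by (rule prime_count_le_length[OF assms])
  ultimately show "4 * prime_count x \<le> x + 13" "4 * prime_count x \<le> max x 120"
    unfolding add_0 by linarith+
qed

text \<open>Primes above 7 are coprime to 210 = 2 * 3 * 5 * 7, and 210 consecutive numbers contain
  exactly 48 such residues.\<close>

lemma prime_count_add_210:
  assumes "7 \<le> x"
  shows "prime_count (x + 210) \<le> prime_count x + 48"
proof -
  define R where "R = filter (\<lambda>r. r mod 2 \<noteq> 0 \<and> r mod 3 \<noteq> 0 \<and> r mod 5 \<noteq> 0 \<and> r mod 7 \<noteq> 0) [0..209::int]"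
  have len: "length R = 48" unfolding R_def by code_simp
  let ?P = "{p::nat. prime p \<and> x < p \<and> p \<le> x + 210}"
  have eq: "p = q" if "q \<le> p" "p mod 210 = q mod 210" "x < q" "p \<le> x + 210" for p q :: nat
  proof -
    have "210 dvd p - q" using that by (simp add: mod_eq_dvd_iff_nat)
    moreover have "p - q < 210" using that by linarith
    ultimately have "p - q = 0" using nat_dvd_not_less by blast
    with that show ?thesis by simp
  qed
  have "inj_on (\<lambda>p. int (p mod 210)) ?P"
  proof (rule inj_onI)
    fix p q :: nat assume pq: "p \<in> ?P" "q \<in> ?P" "int (p mod 210) = int (q mod 210)"
    hence "p mod 210 = q mod 210" by (simp only: of_nat_eq_iff)
    thus "p = q" using eq[of q p] eq[of p q] pq(1,2) by (cases "q \<le> p") simp_all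
  qed
  moreover have "(\<lambda>p. int (p mod 210)) ` ?P \<subseteq> set R"
  proof
    fix r assume "r \<in> (\<lambda>p. int (p mod 210)) ` ?P"
    then obtain p where p: "prime p" "7 < p" "r = int (p mod 210)" using assms by auto
    have dvd: "q = p" if "q dvd p" "prime q" for q :: nat
      using that p(1) primes_dvd_imp_eq by blast
    have nd: "\<not> 2 dvd p" "\<not> 3 dvd p" "\<not> 5 dvd p" "\<not> 7 dvd p"
      using dvd[of 2] dvd[of 3] dvd[of 5] dvd[of 7] p(2) by auto
    have nz: "int (p mod 210) mod int q \<noteq> 0" if "q dvd 210" "\<not> q dvd p" for q
    proof -
      have "p mod 210 mod q \<noteq> 0" using that by (simp add: mod_mod_cancel dvd_eq_mod_eq_0)
      thus ?thesis unfolding zmod_int[symmetric] by (simp only: of_nat_eq_0_iff not_False_eq_True)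
    qed
    have "r mod 2 \<noteq> 0" "r mod 3 \<noteq> 0" "r mod 5 \<noteq> 0" "r mod 7 \<noteq> 0"
      using nz[OF _ nd(1)] nz[OF _ nd(2)] nz[OF _ nd(3)] nz[OF _ nd(4)] unfolding p(3) by simp_all
    moreover have "p mod 210 < 210" by simp
    hence "0 \<le> r" "r \<le> 209" unfolding p(3) by linarith+
    ultimately show "r \<in> set R"
      unfolding R_def set_filter set_upto mem_Collect_eq atLeastAtMost_iff by blast
  qed
  ultimately have "card ?P \<le> card (set R)" by (intro card_inj_on_le[where f = "\<lambda>p. int (p mod 210)"]) simp_all
  also have "\<dots> \<le> 48" using card_length[of R] len by simp
  finally have "card ?P \<le> 48" .
  moreover have "{p. prime p \<and> p \<le> x + 210} = {p. prime p \<and> p \<le> x} \<union> ?P" by auto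
  hence "prime_count (x + 210) \<le> prime_count x + card ?P"
    unfolding prime_count_def by (simp only: card_Un_le)
  ultimately show ?thesis by linarith
qed

text \<open>Steps of 210 preserve the bound because 4 * 48 = 192 < 210. From 512 on the predecessor
  is still above 120.\<close>

lemma four_prime_count_le_max: "4 * prime_count x \<le> max x 120"
proof (induction x rule: less_induct)
  case (less x)
  show ?case
  proof (cases "x < 512")
    case True
    thus ?thesis by (rule prime_count_quarter_base)
  next
    case False
    hence "prime_count x \<le> prime_count (x - 210) + 48" using prime_count_add_210[of "x - 210"] by simp
    moreover have "4 * prime_count (x - 210) \<le> max (x - 210) 120" using False by (intro less.IH) auto
    ultimately show ?thesis using False by linarith
  qed
qed

lemma four_prime_count_le: "4 * prime_count x \<le> x + 13"
proof (cases "x < 512")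
  case False
  thus ?thesis using four_prime_count_le_max[of x] by linarith
qed (rule prime_count_quarter_base)

section \<open>Comparing powers with factorials\<close>

text \<open>Invariant of \<open>power_check b (k # ks) f w ps\<close>: \<open>f = (k - 1)!\<close>, \<open>w = b^e\<close> with
  \<open>e + pi(2k) \<le> k\<close>, and \<open>ps\<close> lists the primes above \<open>2k\<close>.\<close>

primrec power_check :: "int \<Rightarrow> int list \<Rightarrow> int \<Rightarrow> int \<Rightarrow> int list \<Rightarrow> bool" where
  "power_check b [] f w ps = True"
| "power_check b (k # ks) f w ps = (f < w \<and> ps \<noteq> [] \<and>
    (if hd ps = 2 * k + 1 then power_check b ks (k * f) w (tl ps)
     else 2 * k + 1 < hd ps \<and> power_check b ks (k * f) (b * w) ps))"

text \<open>From k to k + 1 the prime count at 2k grows exactly if 2k + 1 is prime. Then the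
  exponent \<open>e\<close> stays and the prime leaves the list; otherwise \<open>e\<close> may grow
  by one.\<close>

lemma power_check_imp:
  assumes "power_check (int b) [int k..int l] (fact (k - 1)) (int b ^ e) ps" "sorted ps"
    "\<And>p::nat. prime p \<Longrightarrow> 2 * k < p \<Longrightarrow> p < 512 \<Longrightarrow> int p \<in> set ps"
    "e + prime_count (2 * k) \<le> k" "1 \<le> k" "k \<le> j" "j \<le> l" "l < 255" "1 \<le> b"
  shows "fact (j - 1) < b ^ (j - prime_count (2 * j))"
  using assms
proof (induction "j - k" arbitrary: k e ps)
  case 0
  hence jk: "j = k" by simp
  have "[int k..int l] = int k # [int k + 1..int l]" using 0 by (simp add: upto_rec1)
  with 0 have "fact (k - 1) < int b ^ e" by simp
  hence "int (fact (k - 1)) < int (b ^ e)" by simp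
  hence "fact (k - 1) < b ^ e" by (simp only: of_nat_less_iff)
  also have "\<dots> \<le> b ^ (k - prime_count (2 * k))" using 0 by (intro power_increasing) auto
  finally show ?case using jk by simp
next
  case (Suc d)
  have upto: "[int k..int l] = int k # [int (Suc k)..int l]"
    using Suc.hyps(2) Suc.prems by (simp add: upto_rec1 add.commute)
  from Suc.prems(1)[unfolded upto] obtain q qs where q: "ps = q # qs" by (cases ps) auto
  have fact: "int k * fact (k - 1) = fact (Suc k - 1)"
    using Suc.prems(5) by (simp add: fact_reduce)
  note pc = prime_count_double_Suc[OF Suc.prems(5)]
  show ?case
  proof (cases "q = 2 * int k + 1")
    case True
    show ?thesis
    proof (rule Suc.hyps(1)[of "Suc k" e qs])
      show "power_check (int b) [int (Suc k)..int l] (fact (Suc k - 1)) (int b ^ e) qs"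
        using Suc.prems(1) unfolding upto q using True fact by simp
      show "int p \<in> set qs" if "prime p" "2 * Suc k < p" "p < 512" for p :: nat
        using Suc.prems(3)[of p] that True q by auto
    qed (use Suc.hyps(2) Suc.prems pc q in auto)
  next
    case False
    with Suc.prems(1) have less: "2 * int k + 1 < q" unfolding upto q by simp
    have "int (2 * k + 1) \<notin> set ps" using less Suc.prems(2) unfolding q by auto
    hence "\<not> prime (2 * k + 1)" using Suc.prems(3)[of "2 * k + 1"] Suc.hyps(2) Suc.prems by auto
    show ?thesis
    proof (rule Suc.hyps(1)[of "Suc k" "Suc e" ps])
      show "power_check (int b) [int (Suc k)..int l] (fact (Suc k - 1)) (int b ^ Suc e) ps"
        using Suc.prems(1) unfolding upto q using False fact by simp
    qed (use Suc.hyps(2) Suc.prems pc \<open>\<not> prime (2 * k + 1)\<close> in auto)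
  qed
qed

lemma mem_dropWhile: "x \<in> set xs \<Longrightarrow> \<not> P x \<Longrightarrow> x \<in> set (dropWhile P xs)"
  by (induction xs) auto

lemma fact_less_power:
  assumes "power_check (int b) [int k..int l] (fact (k - 1)) (int b ^ e)
      (dropWhile (\<lambda>p. p \<le> 2 * int k) primes_512)"
    and "e + length (filter (\<lambda>p. p \<le> int (2 * k)) primes_512) \<le> k"
    and "1 \<le> k" "k \<le> j" "j \<le> l" "l < 255" "1 \<le> b"
  shows "fact (j - 1) < b ^ (j - prime_count (2 * j))"
proof (rule power_check_imp[OF assms(1) _ _ _ assms(3-7)])
  show "sorted (dropWhile (\<lambda>p. p \<le> 2 * int k) primes_512)"
    by (rule sorted_dropWhile[OF sorted_primes_512])
  show "int p \<in> set (dropWhile (\<lambda>p. p \<le> 2 * int k) primes_512)"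
    if "prime p" "2 * k < p" "p < 512" for p :: nat
    using that by (intro mem_dropWhile prime_less_512_imp_mem) auto
  have "2 * k < 512" using assms by linarith
  from prime_count_le_length[OF this] assms(2) show "e + prime_count (2 * k) \<le> k" by linarith
qed

text \<open>The initial exponent is 14 - pi(28) = 14 - 9 = 5.\<close>

lemma fact_less_500_power:
  assumes "14 \<le> j" "j \<le> 33"
  shows "fact (j - 1) < (500 :: nat) ^ (j - prime_count (2 * j))"
proof (rule fact_less_power[where k = 14 and l = 33 and e = 5])
  have dw: "dropWhile (\<lambda>p. p \<le> 2 * int 14) primes_512 =
      [29, 31, 37, 41, 43, 47, 53, 59, 61, 67, 71, 73, 79, 83, 89, 97, 101, 103, 107, 109,
      113, 127, 131, 137, 139, 149, 151, 157, 163, 167, 173, 179, 181, 191, 193, 197, 199,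
      211, 223, 227, 229, 233, 239, 241, 251, 257, 263, 269, 271, 277, 281, 283, 293, 307,
      311, 313, 317, 331, 337, 347, 349, 353, 359, 367, 373, 379, 383, 389, 397, 401, 409,
      419, 421, 431, 433, 439, 443, 449, 457, 461, 463, 467, 479, 487, 491, 499, 503, 509]"
    by (simp add: primes_512_def)
  have fct: "fact (14 - 1) = (6227020800 :: int)" by (simp add: fact_numeral)
  have pw: "int 500 ^ 5 = 31250000000000" by simp
  show "power_check (int 500) [int 14..int 33] (fact (14 - 1)) (int 500 ^ 5)
      (dropWhile (\<lambda>p. p \<le> 2 * int 14) primes_512)"
    unfolding dw fct pw of_nat_numeral by code_simp
  show "5 + length (filter (\<lambda>p. p \<le> int (2 * 14)) primes_512) \<le> 14"
    by (simp add: primes_512_def)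
qed (use assms in auto)

text \<open>The initial exponent is 34 - pi(68) = 34 - 19 = 15.\<close>

lemma fact_less_1300_power:
  assumes "34 \<le> j" "j \<le> 199"
  shows "fact (j - 1) < (1300 :: nat) ^ (j - prime_count (2 * j))"
proof (rule fact_less_power[where k = 34 and l = 199 and e = 15])
  have dw: "dropWhile (\<lambda>p. p \<le> 2 * int 34) primes_512 =
      [71, 73, 79, 83, 89, 97, 101, 103, 107, 109, 113, 127, 131, 137, 139, 149, 151, 157,
      163, 167, 173, 179, 181, 191, 193, 197, 199, 211, 223, 227, 229, 233, 239, 241, 251,
      257, 263, 269, 271, 277, 281, 283, 293, 307, 311, 313, 317, 331, 337, 347, 349, 353,
      359, 367, 373, 379, 383, 389, 397, 401, 409, 419, 421, 431, 433, 439, 443, 449, 457,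
      461, 463, 467, 479, 487, 491, 499, 503, 509]"
    by (simp add: primes_512_def)
  have fct: "fact (34 - 1) = (8683317618811886495518194401280000000 :: int)" by (simp add: fact_numeral)
  have pw: "int 1300 ^ 15 = 51185893014090757000000000000000000000000000000" by simp
  show "power_check (int 1300) [int 34..int 199] (fact (34 - 1)) (int 1300 ^ 15)
      (dropWhile (\<lambda>p. p \<le> 2 * int 34) primes_512)"
    unfolding dw fct pw of_nat_numeral by code_simp
  show "15 + length (filter (\<lambda>p. p \<le> int (2 * 34)) primes_512) \<le> 34"
    by (simp add: primes_512_def)
qed (use assms in auto)

section \<open>Short runs\<close>

text \<open>The obstruction to shrinking the support of a kernel vector below \<open>k\<close>: no
  prime above \<open>2 * k\<close> divides any of \<open>n\<close>, ...,
  \<open>n - k + 1\<close>.\<close>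

definition smooth_run :: "nat \<Rightarrow> nat \<Rightarrow> bool" where
  "smooth_run n k \<longleftrightarrow> (\<forall>i<k. \<not> prime (n - i) \<and> (\<forall>p. prime p \<longrightarrow> p dvd n - i \<longrightarrow> p \<le> 2 * k))"

text \<open>A pair \<open>(p, q)\<close> stands for the number \<open>pq\<close> with prime factor \<open>p\<close>: every window of
  length \<open>k\<close> contains such a number that is prime or has \<open>p > 2k\<close>.\<close>

primrec landmark_check :: "int \<Rightarrow> int \<Rightarrow> (int \<times> int) list \<Rightarrow> bool" where
  "landmark_check k m [] = True"
| "landmark_check k m (x # xs) = (case x of (p, q) \<Rightarrow> (q = 1 \<or> 2 * k < p) \<and>
     m < p * q \<and> p * q \<le> m + k \<and> landmark_check k (p * q) xs)"

lemma landmark_check_imp: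
  assumes "landmark_check (int k) (int m) xs" "\<forall>x\<in>set xs. fst x \<in> set primes_512" "m < a" "xs \<noteq> []" "int a \<le> fst (last xs) * snd (last xs)"
  shows "\<exists>p b. prime p \<and> p dvd b \<and> (p = b \<or> 2 * k < p) \<and> a \<le> b \<and> b < a + k"
  using assms
proof (induction xs arbitrary: m)
  case (Cons x xs)
  obtain p q where x: "x = (p, q)" by (cases x)
  have p: "prime p" "q = 1 \<or> 2 * int k < p" "int m < p * q" "p * q \<le> int m + int k"
    "landmark_check (int k) (p * q) xs"
    using Cons.prems(1,2) by (auto simp: x intro: primes_512_prime)
  have "0 < p" using p(1) by (rule prime_gt_0_int)
  moreover have "0 < p * q" using p(3) by linarith
  ultimately have q: "0 < q" by (rule zero_less_mult_pos[rotated])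
  show ?case
  proof (cases "int a \<le> p * q")
    case True
    have "prime (nat p)" using p(1) by simp
    moreover have "nat p dvd nat (p * q)" using p(1) q by (simp add: nat_mult_distrib prime_ge_0_int)
    moreover have "nat p = nat (p * q) \<or> 2 * k < nat p" using p(2) by auto
    moreover have "a \<le> nat (p * q)" "nat (p * q) < a + k"
      using True p(4) Cons.prems(3) by linarith+
    ultimately show ?thesis by blast
  next
    case False
    define b where "b = nat (p * q)"
    have b: "p * q = int b" using p(3) by (simp add: b_def)
    show ?thesis using Cons.prems(2,5) False p(5) unfolding b
      by (intro Cons.IH[of b]) (auto simp: x b split: if_splits)
  qed
qed simp

lemma not_smooth_run_if_landmarks:
  assumes "landmark_check (int k) (int m) xs" "\<forall>x\<in>set xs. fst x \<in> set primes_512" "xs \<noteq> []" "fst (last xs) * snd (last xs) = int b"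
    and "m + k \<le> n" "n < b + k"
  shows "\<not> smooth_run n k"
proof
  assume run: "smooth_run n k"
  obtain p c where c: "prime p" "p dvd c" "p = c \<or> 2 * k < p" "n - k + 1 \<le> c" "c < n - k + 1 + k"
  proof -
    have "m < n - k + 1" "int (n - k + 1) \<le> fst (last xs) * snd (last xs)"
      using assms(4-6) by linarith+
    from landmark_check_imp[OF assms(1,2) this(1) assms(3) this(2)] that show thesis by blast
  qed
  define i where "i = n - c"
  have "i < k" "c = n - i" using c assms(5) by (auto simp: i_def)
  hence "\<not> prime c" "p \<le> 2 * k" using run c(1,2) unfolding smooth_run_def by blast+
  thus False using c(1,3) by auto
qed

section \<open>Landmark tables for runs of length 2 to 13\<close>

lemma not_smooth_run_2: "11 \<le> n \<Longrightarrow> n \<le> 27 \<Longrightarrow> \<not> smooth_run n 2"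
proof (rule not_smooth_run_if_landmarks[where k = 2 and m = 9 and b = 26])
  show "landmark_check (int 2) (int 9)
      [(11,1), (13,1), (5,3), (17,1), (19,1), (7,3), (23,1), (5,5), (13,2)]"
    unfolding of_nat_numeral by code_simp
qed (auto simp: primes_512_def)

lemma not_smooth_run_3: "11 \<le> n \<Longrightarrow> n \<le> 27 \<Longrightarrow> \<not> smooth_run n 3"
proof (rule not_smooth_run_if_landmarks[where k = 3 and m = 8 and b = 26])
  show "landmark_check (int 3) (int 8)
      [(11,1), (7,2), (17,1), (19,1), (11,2), (23,1), (13,2)]"
    unfolding of_nat_numeral by code_simp
qed (auto simp: primes_512_def)

lemma not_smooth_run_4: "11 \<le> n \<Longrightarrow> n \<le> 27 \<Longrightarrow> \<not> smooth_run n 4"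
proof (rule not_smooth_run_if_landmarks[where k = 4 and m = 7 and b = 26])
  show "landmark_check (int 4) (int 7)
      [(11,1), (13,1), (17,1), (19,1), (23,1), (13,2)]"
    unfolding of_nat_numeral by code_simp
qed (auto simp: primes_512_def)

lemma not_smooth_run_5: "11 \<le> n \<Longrightarrow> n \<le> 28 \<Longrightarrow> \<not> smooth_run n 5"
proof (rule not_smooth_run_if_landmarks[where k = 5 and m = 6 and b = 26])
  show "landmark_check (int 5) (int 6)
      [(11,1), (13,1), (17,1), (11,2), (13,2)]"
    unfolding of_nat_numeral by code_simp
qed (auto simp: primes_512_def)

lemma not_smooth_run_6: "12 \<le> n \<Longrightarrow> n \<le> 125 \<Longrightarrow> \<not> smooth_run n 6"
proof (rule not_smooth_run_if_landmarks[where k = 6 and m = 6 and b = 124])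
  show "landmark_check (int 6) (int 6)
      [(11,1), (17,1), (23,1), (29,1), (17,2), (13,3), (43,1), (47,1), (53,1), (59,1),
      (13,5), (71,1), (19,4), (41,2), (29,3), (31,3), (97,1), (103,1), (109,1), (23,5),
      (17,7), (31,4)]"
    unfolding of_nat_numeral by code_simp
qed (auto simp: primes_512_def)

lemma not_smooth_run_7: "14 \<le> n \<Longrightarrow> n \<le> 726 \<Longrightarrow> \<not> smooth_run n 7"
proof (rule not_smooth_run_if_landmarks[where k = 7 and m = 7 and b = 725])
  show "landmark_check (int 7) (int 7)
      [(13,1), (19,1), (23,1), (29,1), (17,2), (41,1), (47,1), (53,1), (59,1), (31,2),
      (23,3), (19,4), (83,1), (89,1), (19,5), (17,6), (109,1), (29,4), (41,3), (43,3),
      (17,8), (71,2), (149,1), (31,5), (23,7), (167,1), (29,6), (181,1), (47,4), (97,2),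
      (67,3), (23,9), (107,2), (17,13), (19,12), (47,5), (241,1), (31,8), (17,15),
      (131,2), (269,1), (23,12), (283,1), (29,10), (37,8), (101,3), (31,10), (317,1),
      (17,19), (47,7), (67,5), (19,18), (349,1), (89,4), (181,2), (41,9), (47,8), (383,1),
      (389,1), (79,5), (67,6), (409,1), (83,5), (211,2), (107,4), (29,15), (17,26),
      (449,1), (19,24), (463,1), (47,10), (53,9), (23,21), (163,3), (31,16), (503,1),
      (17,30), (47,11), (131,4), (59,9), (269,2), (109,5), (23,24), (43,13), (283,2),
      (191,3), (29,20), (293,2), (37,16), (23,26), (151,4), (47,13), (103,6), (89,7),
      (17,37), (53,12), (107,6), (59,11), (41,16), (17,39), (67,10), (337,2), (227,3),
      (43,16), (139,5), (233,3), (353,2), (23,31), (359,2), (29,25)]"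
    unfolding of_nat_numeral by code_simp
qed (auto simp: primes_512_def)

lemma not_smooth_run_8: "16 \<le> n \<Longrightarrow> n \<le> 77 \<Longrightarrow> \<not> smooth_run n 8"
proof (rule not_smooth_run_if_landmarks[where k = 8 and m = 8 and b = 76])
  show "landmark_check (int 8) (int 8)
      [(13,1), (19,1), (23,1), (31,1), (19,2), (23,2), (53,1), (61,1), (23,3), (19,4)]"
    unfolding of_nat_numeral by code_simp
qed (auto simp: primes_512_def)

lemma not_smooth_run_9: "18 \<le> n \<Longrightarrow> n \<le> 208 \<Longrightarrow> \<not> smooth_run n 9"
proof (rule not_smooth_run_if_landmarks[where k = 9 and m = 9 and b = 207])
  show "landmark_check (int 9) (int 9)
      [(17,1), (23,1), (31,1), (19,2), (47,1), (53,1), (31,2), (71,1), (79,1), (29,3),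
      (19,5), (103,1), (37,3), (59,2), (127,1), (67,2), (71,2), (151,1), (53,3), (167,1),
      (29,6), (61,3), (191,1), (199,1), (23,9)]"
    unfolding of_nat_numeral by code_simp
qed (auto simp: primes_512_def)

lemma not_smooth_run_10: "20 \<le> n \<Longrightarrow> n \<le> 611 \<Longrightarrow> \<not> smooth_run n 10"
proof (rule not_smooth_run_if_landmarks[where k = 10 and m = 10 and b = 602])
  show "landmark_check (int 10) (int 10)
      [(19,1), (29,1), (37,1), (47,1), (53,1), (31,2), (71,1), (79,1), (89,1), (97,1),
      (107,1), (29,4), (31,4), (67,2), (71,2), (151,1), (23,7), (167,1), (59,3), (31,6),
      (97,2), (29,7), (71,3), (223,1), (233,1), (241,1), (251,1), (29,9), (271,1),
      (281,1), (97,3), (43,7), (311,1), (107,3), (331,1), (31,11), (349,1), (359,1),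
      (41,9), (379,1), (389,1), (199,2), (37,11), (139,3), (61,7), (23,19), (149,3),
      (457,1), (467,1), (53,9), (487,1), (71,7), (23,22), (43,12), (263,2), (67,8),
      (109,5), (37,15), (113,5), (23,25), (73,8), (37,16), (43,14)]"
    unfolding of_nat_numeral by code_simp
qed (auto simp: primes_512_def)

lemma not_smooth_run_11: "22 \<le> n \<Longrightarrow> n \<le> 163 \<Longrightarrow> \<not> smooth_run n 11"
proof (rule not_smooth_run_if_landmarks[where k = 11 and m = 11 and b = 159])
  show "landmark_check (int 11) (int 11)
      [(19,1), (29,1), (37,1), (47,1), (29,2), (23,3), (79,1), (89,1), (97,1), (107,1),
      (59,2), (43,3), (139,1), (149,1), (53,3)]"
    unfolding of_nat_numeral by code_simp
qed (auto simp: primes_512_def)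

lemma not_smooth_run_12: "24 \<le> n \<Longrightarrow> n \<le> 352 \<Longrightarrow> \<not> smooth_run n 12"
proof (rule not_smooth_run_if_landmarks[where k = 12 and m = 12 and b = 341])
  show "landmark_check (int 12) (int 12)
      [(23,1), (31,1), (43,1), (53,1), (31,2), (37,2), (43,2), (97,1), (109,1), (59,2),
      (43,3), (47,3), (151,1), (163,1), (29,6), (31,6), (197,1), (103,2), (109,2),
      (229,1), (241,1), (251,1), (263,1), (137,2), (71,4), (37,8), (307,1), (29,11),
      (331,1), (31,11)]"
    unfolding of_nat_numeral by code_simp
qed (auto simp: primes_512_def)

lemma not_smooth_run_13: "26 \<le> n \<Longrightarrow> n \<le> 159 \<Longrightarrow> \<not> smooth_run n 13"
proof (rule not_smooth_run_if_landmarks[where k = 13 and m = 13 and b = 159])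
  show "landmark_check (int 13) (int 13)
      [(23,1), (31,1), (43,1), (53,1), (31,2), (37,2), (29,3), (97,1), (109,1), (61,2),
      (67,2), (73,2), (53,3)]"
    unfolding of_nat_numeral by code_simp
qed (auto simp: primes_512_def)

section \<open>Neighbouring numbers of the form 2^a 3^b\<close>

definition three_smooth :: "nat \<Rightarrow> bool" where
  "three_smooth n \<longleftrightarrow> (\<forall>p. prime p \<longrightarrow> p dvd n \<longrightarrow> p = 2 \<or> p = 3)"

lemma three_smooth_imp_form:
  assumes "three_smooth n" "0 < n"
  shows "\<exists>a b. n = 2 ^ a * 3 ^ b"
  using assms
proof (induction n rule: less_induct)
  case (less n)
  show ?case
  proof (cases "n = 1")
    case True
    thus ?thesis by (intro exI[of _ 0]) simp
  next
    case False
    then obtain p where p: "prime p" "p dvd n" using prime_factor_nat by blast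
    then obtain m where m: "n = p * m" by blast
    have p23: "p = 2 \<or> p = 3" using less.prems p unfolding three_smooth_def by blast
    have "three_smooth m" using less.prems(1) unfolding three_smooth_def m by (meson dvd_mult)
    moreover have "0 < m" "m < n" using less.prems(2) p23 unfolding m by auto
    ultimately obtain a b where "m = 2 ^ a * 3 ^ b" using less.IH by blast
    hence "n = 2 ^ Suc a * 3 ^ b \<or> n = 2 ^ a * 3 ^ Suc b" using p23 m by auto
    thus ?thesis by blast
  qed
qed

lemma pow3_mod_8: "(3::nat) ^ n mod 8 = (if even n then 1 else 3)"
proof (induction n)
  case (Suc n)
  have "(3::nat) ^ Suc n mod 8 = 3 * (3 ^ n mod 8) mod 8" by (simp add: mod_mult_right_eq)
  also have "\<dots> = (if even (Suc n) then 1 else 3)" unfolding Suc.IH by simp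
  finally show ?case .
qed simp

text \<open>Modulo 8 the left-hand side is 2 or 4, never 0.\<close>

lemma pow3_Suc_eq_pow2_imp:
  assumes "(3::nat) ^ b + 1 = 2 ^ c"
  shows "c \<le> 2"
proof (rule ccontr)
  assume "\<not> ?thesis"
  hence "(2::nat) ^ 3 dvd 2 ^ c" by (intro le_imp_power_dvd) simp
  hence "(3 ^ b + 1) mod 8 = (0::nat)" using assms by simp
  hence "(3 ^ b mod 8 + 1) mod 8 = (0::nat)" by (simp add: mod_Suc_eq)
  thus False by (simp add: pow3_mod_8 split: if_splits)
qed

text \<open>If 16 divides \<open>2 ^ a\<close>, then \<open>3 ^ d\<close> is 1 modulo 16, so 4
  divides d. But then \<open>3 ^ d\<close> is a power of 81, hence 1 modulo 5, and 5 would divide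
  \<open>2 ^ a\<close>.\<close>

lemma pow2_Suc_eq_pow3_imp:
  assumes "(2::nat) ^ a + 1 = 3 ^ d"
  shows "a \<le> 3"
proof (rule ccontr)
  assume "\<not> ?thesis"
  hence "(2::nat) ^ 4 dvd 2 ^ a" by (intro le_imp_power_dvd) simp
  hence 16: "(3::nat) ^ d mod 16 = 1" unfolding assms[symmetric] by (auto elim!: dvdE simp: mod_Suc)
  define q r where "q = d div 4" and "r = d mod 4"
  have d: "d = 4 * q + r" by (simp add: q_def r_def)
  have "(81::nat) ^ q mod 16 = 1" using power_mod[of "81 :: nat" 16 q] by simp
  hence "(3::nat) ^ r mod 16 = 1"
    using 16 mod_mult_left_eq[of "81 ^ q" 16 "3 ^ r :: nat"] unfolding d power_add power_mult by simp
  moreover have "r \<in> {0, 1, 2, 3}" unfolding r_def by auto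
  ultimately have "r = 0" by auto
  have "(81::nat) ^ q mod 5 = 1" using power_mod[of "81 :: nat" 5 q] by simp
  hence "(2 ^ a + 1) mod 5 = (1::nat)" unfolding assms d power_add power_mult \<open>r = 0\<close> by simp
  hence "5 dvd (2::nat) ^ a" by presburger
  hence "5 dvd (2::nat)" by (rule prime_dvd_power_nat[rotated]) simp
  thus False by simp
qed

text \<open>The two numbers are coprime, so one is a power of 2 and the other a power of 3. The
  extremal pair is 8, 9.\<close>

lemma three_smooth_Suc_le:
  assumes "three_smooth x" "three_smooth (x + 1)" "0 < x"
  shows "x \<le> 8"
proof -
  obtain a b where x: "x = 2 ^ a * 3 ^ b" using three_smooth_imp_form assms by blast
  obtain c d where x1: "x + 1 = 2 ^ c * 3 ^ d" using three_smooth_imp_form assms by fastforce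
  have 2: "\<not> (2 dvd x \<and> 2 dvd x + 1)" and 3: "\<not> (3 dvd x \<and> 3 dvd x + 1)" by presburger+
  have "a = 0 \<or> c = 0" using 2 unfolding x1 unfolding x by (cases a; cases c) auto
  moreover have "b = 0 \<or> d = 0" using 3 unfolding x1 unfolding x by (cases b; cases d) auto
  ultimately consider "a = 0" "b = 0" | "a = 0" "d = 0" | "c = 0" "d = 0" | "c = 0" "b = 0" by blast
  thus ?thesis
  proof cases
    case 2
    hence "3 ^ b + 1 = (2::nat) ^ c" using x x1 by simp
    moreover from this have "c \<le> 2" by (rule pow3_Suc_eq_pow2_imp)
    hence "(2::nat) ^ c \<le> 2 ^ 2" by (intro power_increasing) auto
    ultimately show ?thesis using x 2 by simp
  next
    case 4
    hence "2 ^ a + 1 = (3::nat) ^ d" using x x1 by simp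
    hence "a \<le> 3" by (rule pow2_Suc_eq_pow3_imp)
    hence "(2::nat) ^ a \<le> 2 ^ 3" by (intro power_increasing) auto
    thus ?thesis using x 4 by simp
  qed (use x x1 assms in auto)
qed

lemma three_smooth_divD: "three_smooth (p * x) \<Longrightarrow> three_smooth x"
  unfolding three_smooth_def by (meson dvd_mult)

text \<open>For e = 2 or 3, if e divides x, division by e leads to consecutive numbers and x \<le>
  8e \<le> 24. Otherwise x is a power of the other prime; unless x = 1, neither 2 nor 3 divides x +
  e, which would then be 1.\<close>

lemma three_smooth_diff_le:
  assumes "three_smooth x" "three_smooth (x + e)" "0 < x" "e \<in> {1, 2, 3}"
  shows "x \<le> 24"
proof -
  obtain a b where x: "x = 2 ^ a * 3 ^ b" using three_smooth_imp_form assms by blast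
  obtain c d where xe: "x + e = 2 ^ c * 3 ^ d" using three_smooth_imp_form[OF assms(2)] assms(3) by auto
  consider "e = 1" | "e = 2" "a = 0" | "e = 2" "0 < a" | "e = 3" "b = 0" | "e = 3" "0 < b"
    using assms(4) by auto
  thus ?thesis
  proof cases
    case 1
    thus ?thesis using three_smooth_Suc_le[of x] assms by simp
  next
    case 2
    have "\<not> 2 dvd x + e" using 2 x by simp
    hence "c = 0" unfolding xe by (cases c) auto
    show ?thesis
    proof (cases b)
      case (Suc b')
      hence "3 dvd x" using x by simp
      hence "\<not> 3 dvd x + 2" by presburger
      hence "\<not> 3 dvd x + e" using 2 by simp
      hence "d = 0" unfolding xe by (cases d) auto
      thus ?thesis using xe \<open>c = 0\<close> assms(3) by simp
    qed (use 2 x in simp)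
  next
    case 3
    then obtain a' where "a = Suc a'" using gr0_implies_Suc by blast
    define y :: nat where "y = 2 ^ a' * 3 ^ b"
    have y: "x = 2 * y" unfolding x y_def \<open>a = Suc a'\<close> by simp
    have xe': "x + e = 2 * (y + 1)" using y 3 by simp
    have "three_smooth y" using assms(1) unfolding y by (rule three_smooth_divD)
    moreover have "three_smooth (y + 1)" using assms(2) unfolding xe' by (rule three_smooth_divD)
    ultimately show ?thesis using three_smooth_Suc_le[of y] y assms(3) by simp
  next
    case 4
    have "\<not> 3 dvd x + e"
    proof
      assume "3 dvd x + e"
      hence "3 dvd x" using 4 by (simp add: dvd_add_left_iff)
      hence "3 dvd (2::nat) ^ a" using 4 x by simp
      hence "3 dvd (2::nat)" by (rule prime_dvd_power_nat[rotated]) simp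
      thus False by simp
    qed
    hence "d = 0" unfolding xe by (cases d) auto
    show ?thesis
    proof (cases a)
      case (Suc a')
      hence "\<not> 2 dvd x + e" using 4 x by simp
      hence "c = 0" unfolding xe by (cases c) auto
      thus ?thesis using xe \<open>d = 0\<close> assms(3) by simp
    qed (use 4 x in simp)
  next
    case 5
    then obtain b' where "b = Suc b'" using gr0_implies_Suc by blast
    define y :: nat where "y = 2 ^ a * 3 ^ b'"
    have y: "x = 3 * y" unfolding x y_def \<open>b = Suc b'\<close> by simp
    have xe': "x + e = 3 * (y + 1)" using y 5 by simp
    have "three_smooth y" using assms(1) unfolding y by (rule three_smooth_divD)
    moreover have "three_smooth (y + 1)" using assms(2) unfolding xe' by (rule three_smooth_divD)
    ultimately show ?thesis using three_smooth_Suc_le[of y] y assms(3) by simp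
  qed
qed

text \<open>Two multiples of d are at least d apart. If there is none, the default index 0
  serves.\<close>

lemma ex_unique_multiple:
  fixes n k d :: nat
  assumes "k \<le> d" "k \<le> n"
  shows "\<exists>a. \<forall>i<k. i \<noteq> a \<longrightarrow> \<not> d dvd n - i"
proof (cases "\<exists>a<k. d dvd n - a")
  case True
  then obtain a where a: "a < k" "d dvd n - a" by blast
  have "\<not> d dvd n - i" if "i < k" "i \<noteq> a" for i
  proof
    assume "d dvd n - i"
    have e: "(n - i) - (n - a) = a - i" "(n - a) - (n - i) = i - a"
      using that a(1) assms by linarith+
    have "d dvd a - i" using dvd_diff_nat[OF \<open>d dvd n - i\<close> a(2)] unfolding e(1) .
    moreover have "d dvd i - a" using dvd_diff_nat[OF a(2) \<open>d dvd n - i\<close>] unfolding e(2) .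
    ultimately have "d dvd (a - i) + (i - a)" by (rule dvd_add)
    moreover have "0 < (a - i) + (i - a)" "(a - i) + (i - a) < d" using that a(1) assms by auto
    ultimately show False by (auto dest: dvd_imp_le)
  qed
  thus ?thesis by (intro exI[of _ a] allI impI)
next
  case False
  thus ?thesis by (intro exI[of _ 0] allI impI notI) simp
qed

text \<open>The primes up to 2k are 2 and 3, together with 5 if k > 2 and 7 if k > 3. Omitting the
  possible multiples of 5 and 7 leaves two 3-smooth terms at distance at most 3, the smaller one
  being at most 24.\<close>

lemma smooth_run_imp_less_28:
  assumes "smooth_run n k" "k \<in> {2, 3, 4}" "k < n"
  shows "n < 28"
proof -
  have k: "k \<le> 5" "k \<le> 7" "k \<le> n" using assms(2,3) by auto
  obtain a where a: "\<forall>i<k. i \<noteq> a \<longrightarrow> \<not> 5 dvd n - i"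
    using ex_unique_multiple[OF k(1,3)] by blast
  obtain b where b: "\<forall>i<k. i \<noteq> b \<longrightarrow> \<not> 7 dvd n - i"
    using ex_unique_multiple[OF k(2,3)] by blast
  have smooth: "three_smooth (n - i)" if "i < k" "2 < k \<longrightarrow> i \<noteq> a" "3 < k \<longrightarrow> i \<noteq> b" for i
    unfolding three_smooth_def
  proof (intro allI impI)
    fix p assume p: "prime p" "p dvd n - i"
    have "p \<le> 2 * k" using assms(1) p that(1) unfolding smooth_run_def by blast
    moreover have "2 < k \<longrightarrow> p \<noteq> 5"
    proof (intro impI notI)
      assume "2 < k" "p = 5"
      hence "\<not> p dvd n - i" using a that by simp
      thus False using p(2) by contradiction
    qed
    moreover have "3 < k \<longrightarrow> p \<noteq> 7"
    proof (intro impI notI)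
      assume "3 < k" "p = 7"
      hence "\<not> p dvd n - i" using b that by simp
      thus False using p(2) by contradiction
    qed
    ultimately have "p \<le> 8" "p \<noteq> 5" "p \<noteq> 7" using assms(2) by auto
    hence "p \<in> {0, 1, 2, 3, 4, 6, 8}" unfolding insert_iff empty_iff by linarith
    moreover have "\<not> prime (0::nat)" "\<not> prime (1::nat)" "\<not> prime (4::nat)" "\<not> prime (6::nat)"
      "\<not> prime (8::nat)" by simp_all
    ultimately show "p = 2 \<or> p = 3" using p(1) by blast
  qed
  have "\<exists>(i, j)\<in>{(0, 1), (0, 2), (0, 3), (1, 2), (1, 3), (2, 3)}. j < k \<and>
      (2 < k \<longrightarrow> a \<noteq> i \<and> a \<noteq> j) \<and> (3 < k \<longrightarrow> b \<noteq> i \<and> b \<noteq> j)"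
    using assms(2)
    by (elim insertE emptyE; cases "a = 0"; cases "a = 1"; cases "b = 0"; cases "b = 1";
        cases "a = 2"; cases "b = 2"; simp)
  then obtain i j where ij': "(i, j) \<in> {(0, 1), (0, 2), (0, 3), (1, 2), (1, 3), (2, 3)}"
    and ij: "j < k" "2 < k \<longrightarrow> a \<noteq> i \<and> a \<noteq> j" "3 < k \<longrightarrow> b \<noteq> i \<and> b \<noteq> j"
    by blast
  have "i < j" using ij' by auto
  note ij = this ij
  have "three_smooth (n - j)" by (rule smooth) (use ij in auto)
  moreover have "three_smooth (n - i)" by (rule smooth) (use ij in auto)
  moreover have "n - i = n - j + (j - i)" using ij assms(3) by linarith
  ultimately have "three_smooth (n - j)" "three_smooth (n - j + (j - i))" by simp_all
  moreover have "j - i \<in> {1, 2, 3}" using ij assms(2) by auto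
  ultimately have "n - j \<le> 24" using ij assms(3) by (intro three_smooth_diff_le) auto
  thus ?thesis using ij assms(2) by auto
qed

lemma smooth_run_imp_less:
  assumes "smooth_run n k" "1 \<le> k" "k \<le> n" "fact (k - 1) < b ^ (k - prime_count (2 * k))"
  shows "n - k + 1 < b"
proof (rule ccontr)
  assume "\<not> ?thesis"
  hence "b ^ (k - prime_count (2 * k)) \<le> (n - k + 1) ^ (k - prime_count (2 * k))"
    by (intro power_mono) auto
  also have "\<dots> \<le> fact (k - 1)"
    using assms(1) by (intro smooth_consecutive_power_le assms(2,3)) (auto simp: smooth_run_def)
  finally show False using assms(4) by simp
qed

lemma smooth_run_imp_less_table:
  assumes "smooth_run n k" "1 \<le> k" "k \<le> n" "2 * k < 512" "1 \<le> b"
    and "fact (k - 1) < b ^ (k - length (filter (\<lambda>p. p \<le> int (2 * k)) primes_512))"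
  shows "n - k + 1 < b"
proof (rule smooth_run_imp_less[OF assms(1-3)])
  note assms(6)
  also have "b ^ (k - length (filter (\<lambda>p. p \<le> int (2 * k)) primes_512)) \<le> b ^ (k - prime_count (2 * k))"
    using prime_count_le_length[OF assms(4)] assms(5) by (intro power_increasing) auto
  finally show "fact (k - 1) < b ^ (k - prime_count (2 * k))" .
qed

text \<open>For k \<ge> 5 the constants 25, 121, ..., 148 are the least b with (k - 1)! < b^(k -
  pi(2k)); the landmark tables settle what lies below. For k \<le> 4 the exponent is 0, hence the
  separate argument with 3-smooth numbers.\<close>

lemma not_smooth_run_short:
  assumes "10 < n" "2 \<le> k" "2 * k \<le> n" "k \<le> 13"
  shows "\<not> smooth_run n k"
proof
  assume run: "smooth_run n k"
  note less = smooth_run_imp_less_table[OF run]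
  have "k \<in> {2, 3, 4} \<or> k = 5 \<or> k = 6 \<or> k = 7 \<or> k = 8 \<or> k = 9 \<or> k = 10 \<or> k = 11 \<or> k = 12 \<or> k = 13"
    using assms(2,4) unfolding insert_iff empty_iff by presburger
  then consider "k \<in> {2, 3, 4}" | "k = 5" | "k = 6" | "k = 7" | "k = 8" | "k = 9" | "k = 10" | "k = 11" | "k = 12" | "k = 13"
    by blast
  thus False
  proof cases
    case 1
    hence "n < 28" using assms by (intro smooth_run_imp_less_28[OF run]) auto
    hence n: "11 \<le> n" "n \<le> 27" using assms(1) by simp_all
    have "\<not> smooth_run n 2" "\<not> smooth_run n 3" "\<not> smooth_run n 4"
      using n by (simp_all only: not_smooth_run_2 not_smooth_run_3 not_smooth_run_4 not_False_eq_True)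
    thus False using 1 run by blast
  next
    case 2
    have "n - k + 1 < 25"
      by (rule less) (use 2 assms in \<open>simp_all add: primes_512_def fact_numeral\<close>)
    thus False using 2 run assms not_smooth_run_5[of n] by auto
  next
    case 3
    have "n - k + 1 < 121"
      by (rule less) (use 3 assms in \<open>simp_all add: primes_512_def fact_numeral\<close>)
    thus False using 3 run assms not_smooth_run_6[of n] by auto
  next
    case 4
    have "n - k + 1 < 721"
      by (rule less) (use 4 assms in \<open>simp_all add: primes_512_def fact_numeral\<close>)
    thus False using 4 run assms not_smooth_run_7[of n] by auto
  next
    case 5
    have "n - k + 1 < 71"
      by (rule less) (use 5 assms in \<open>simp_all add: primes_512_def fact_numeral\<close>)
    thus False using 5 run assms not_smooth_run_8[of n] by auto
  next
    case 6
    have "n - k + 1 < 201"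
      by (rule less) (use 6 assms in \<open>simp_all add: primes_512_def fact_numeral\<close>)
    thus False using 6 run assms not_smooth_run_9[of n] by auto
  next
    case 7
    have "n - k + 1 < 603"
      by (rule less) (use 7 assms in \<open>simp_all add: primes_512_def fact_numeral\<close>)
    thus False using 7 run assms not_smooth_run_10[of n] by auto
  next
    case 8
    have "n - k + 1 < 154"
      by (rule less) (use 8 assms in \<open>simp_all add: primes_512_def fact_numeral\<close>)
    thus False using 8 run assms not_smooth_run_11[of n] by auto
  next
    case 9
    have "n - k + 1 < 342"
      by (rule less) (use 9 assms in \<open>simp_all add: primes_512_def fact_numeral\<close>)
    thus False using 9 run assms not_smooth_run_12[of n] by auto
  next
    case 10
    have "n - k + 1 < 148"
      by (rule less) (use 10 assms in \<open>simp_all add: primes_512_def fact_numeral\<close>)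
    thus False using 10 run assms not_smooth_run_13[of n] by auto
  qed
qed

section \<open>Estimates for binomial coefficients\<close>

lemma ln_5_bounds: "ln 5 \<in> {1.609437..1.609439::real}"
  using ln_approx_bounds[of 5 18] by (simp add: eval_nat_numeral)

lemma ln_20_eq: "ln 20 = 2 * ln 2 + ln (5::real)"
  using ln_mult[of "4::real" 5] ln_realpow[of "2::real" 2] by simp

lemma ln_200_eq: "ln 200 = 3 * ln 2 + 2 * ln (5::real)"
  using ln_mult[of "8::real" 25] ln_realpow[of "2::real" 3] ln_realpow[of "5::real" 2] by simp

text \<open>A weak Stirling formula; the induction step is 1/(n + 1) \<le> ln((n + 1)/n) \<le>
  1/n.\<close>

lemma ln_fact_bounds:
  assumes "1 \<le> n"
  shows "real n * ln (real n) - real n + 1 \<le> ln (fact n)"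
    and "ln (fact n) \<le> real n * ln (real n) - real n + 1 + ln (real n)"
proof -
  have "real n * ln (real n) - real n + 1 \<le> ln (fact n) \<and>
    ln (fact n) \<le> real n * ln (real n) - real n + 1 + ln (real n)"
    using assms
  proof (induction n rule: nat_induct_at_least)
    case (Suc n)
    hence n: "1 \<le> real n" by simp
    have "fact (Suc n) = (real n + 1) * fact n" by (simp add: algebra_simps)
    hence fact: "ln (fact (Suc n)) = ln (real n + 1) + ln (fact n)"
      using n by (simp add: ln_mult del: fact_Suc)
    have "ln ((real n + 1) / real n) \<le> (real n + 1) / real n - 1"
      using n by (intro ln_le_minus_one) simp
    hence "real n * (ln (real n + 1) - ln (real n)) \<le> real n * ((real n + 1) / real n - 1)"
      using n by (intro mult_left_mono) (simp_all add: ln_div)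
    hence 1: "real n * ln (real n + 1) \<le> real n * ln (real n) + 1"
      using n by (simp add: field_simps)
    have "ln (real n / (real n + 1)) \<le> real n / (real n + 1) - 1"
      using n by (intro ln_le_minus_one) simp
    hence "(real n + 1) * (ln (real n) - ln (real n + 1)) \<le> (real n + 1) * (real n / (real n + 1) - 1)"
      using n by (intro mult_left_mono) (simp_all add: ln_div)
    hence 2: "(real n + 1) * ln (real n) + 1 \<le> (real n + 1) * ln (real n + 1)"
      using n by (simp add: field_simps)
    have "real (Suc n) = real n + 1" by simp
    thus ?case using Suc.IH 1 2 unfolding fact by (simp add: algebra_simps)
  qed simp
  thus "real n * ln (real n) - real n + 1 \<le> ln (fact n)"
    and "ln (fact n) \<le> real n * ln (real n) - real n + 1 + ln (real n)" by blast+
qed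

lemma ln_binomial_ge:
  assumes "1 \<le> k" "k < n"
  shows "real n * ln (real n) - real k * ln (real k) - (real n - real k) * ln (real n - real k)
    - 2 * ln (real n) - 1 \<le> ln (real (n choose k))"
proof -
  have "real (n choose k) = fact n / (fact k * fact (n - k))"
    using assms by (intro binomial_fact) simp
  hence "ln (real (n choose k)) = ln (fact n) - ln (fact k) - ln (fact (n - k))"
    by (simp add: ln_div ln_mult)
  moreover have "ln (real k) \<le> ln (real n)" "ln (real (n - k)) \<le> ln (real n)"
    using assms by simp_all
  moreover have d: "real (n - k) = real n - real k" using assms by simp
  moreover have "1 \<le> n" "1 \<le> k" "1 \<le> n - k" using assms by auto
  ultimately show ?thesis
    using ln_fact_bounds(1)[of n] ln_fact_bounds(2)[of k] ln_fact_bounds(2)[of "n - k"]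
    unfolding d by linarith
qed

text \<open>With w the square root of n, the sparse estimate takes this form; concavity reduces it
  to the ends of the range.\<close>

lemma linear_times_ln_concave:
  fixes a :: real
  assumes "0 \<le> a" "0 < x"
  shows "concave_on {x..y} (\<lambda>w. (a - w / 2) * ln w)"
proof (rule f''_le0_imp_concave)
  show "((\<lambda>w. (a - w / 2) * ln w) has_real_derivative (a - w / 2) / w - ln w / 2) (at w)"
    if "w \<in> {x..y}" for w
    using that assms by (auto intro!: derivative_eq_intros simp: field_simps)
  show "((\<lambda>w. (a - w / 2) / w - ln w / 2) has_real_derivative - a / w\<^sup>2 - 1 / (2 * w)) (at w)"
    if "w \<in> {x..y}" for w
    using that assms by (auto intro!: derivative_eq_intros simp: field_simps power2_eq_square)
  show "- a / w\<^sup>2 - 1 / (2 * w) \<le> 0" if "w \<in> {x..y}" for w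
  proof -
    have "0 \<le> a / w\<^sup>2" "0 \<le> 1 / (2 * w)" using that assms by auto
    thus ?thesis unfolding minus_divide_left[symmetric] by linarith
  qed
qed simp

lemma binary_entropy_concave:
  assumes "0 < x" "y < 1"
  shows "concave_on {x..y} (\<lambda>q::real. - q * ln q - (1 - q) * ln (1 - q) - c * q)"
proof (rule f''_le0_imp_concave)
  show "((\<lambda>q. - q * ln q - (1 - q) * ln (1 - q) - c * q) has_real_derivative ln (1 - q) - ln q - c) (at q)"
    if "q \<in> {x..y}" for q
  proof -
    have "q \<noteq> 0" "1 - q \<noteq> 0" using that assms by auto
    thus ?thesis using that assms by (auto intro!: derivative_eq_intros)
  qed
  show "((\<lambda>q. ln (1 - q) - ln q - c) has_real_derivative - 1 / (1 - q) - 1 / q) (at q)"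
    if "q \<in> {x..y}" for q
    using that assms by (auto intro!: derivative_eq_intros simp: field_simps)
  show "- 1 / (1 - q) - 1 / q \<le> 0" if "q \<in> {x..y}" for q
  proof -
    have "0 \<le> 1 / (1 - q)" "0 \<le> 1 / q" using that assms by auto
    thus ?thesis unfolding minus_divide_left[symmetric] by linarith
  qed
qed simp

text \<open>The term (n - k) ln(n/(n - k)) is at least 0.95 k since n \<ge> 20k. What remains is
  concave in w = sqrt n, so only w = sqrt(20k) and w = k have to be examined.\<close>

lemma sparse_estimate:
  fixes k n :: real
  assumes k: "200 \<le> k" and n: "20 * k \<le> n" "n \<le> k\<^sup>2"
  shows "5531 / 5000 * (2 * k) + 15 * ln (2 * k) + 46 + (sqrt n + 13) / 4 * ln n
    < n * ln n - k * ln k - (n - k) * ln (n - k) - 2 * ln n - 1"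
proof -
  define w where "w = sqrt n"
  have pos: "0 < n" "0 < k" "k < n" using k n by linarith+
  have w: "0 < w" "sqrt (20 * k) \<le> w" "w \<le> k" "n = w\<^sup>2"
    using pos n k by (auto simp: w_def real_le_lsqrt)
  have lnn: "ln n = 2 * ln w" using w(1) unfolding w(4) by (simp add: ln_realpow)
  \<comment> \<open>\<open>f\<close> collects the multiples of ln n = 2 ln w and \<open>R\<close>
    the terms in k alone: 21/2 = 4 + 13/2 and 1.2624 = 2 * 1.1062 - 0.95.\<close>
  define f where "f w = (2 * k - 21 / 2 - w / 2) * ln w" for w
  define R where "R = k * ln k + 12624 / 10000 * k + 15 * ln (2 * k) + 47"
  have lnk: "ln (2 * k) = ln 2 + ln k" using pos by (simp add: ln_mult)
  have ln200: "ln 200 \<ge> (5298 / 1000 :: real)"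
    unfolding ln_200_eq using ln_2_bounds ln_5_bounds by simp
  have 1: "R < f k"
  proof -
    have "ln 200 \<le> ln k" using k by simp
    hence "5298 / 1000 \<le> ln k" using ln200 by (rule order.trans[rotated])
    hence "(k / 2 - 51 / 2) * (5298 / 1000) \<le> (k / 2 - 51 / 2) * ln k"
      using k by (intro mult_left_mono) auto
    moreover have "f k - R = (k / 2 - 51 / 2) * ln k - 12624 / 10000 * k - 15 * ln 2 - 47"
      unfolding f_def R_def lnk by (simp add: field_simps)
    ultimately show ?thesis using k ln_2_bounds by (simp add: field_simps)
  qed
  have 2: "R < f (sqrt (20 * k))"
  proof -
    \<comment> \<open>With v \<ge> 1, sqrt(20k) = sqrt 4000 * v and ln v \<le> v - 1, the claim
      becomes a quadratic inequality in v.\<close>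
    define v where "v = sqrt (k / 200)"
    have v: "1 \<le> v" "k = 200 * v\<^sup>2" using k by (auto simp: v_def)
    have lnv: "ln v \<le> v - 1" using v by (intro ln_le_minus_one) simp
    have ln5k: "ln k = ln 200 + 2 * ln v" using v by (simp add: ln_mult ln_realpow)
    have ln20: "ln 20 \<ge> (29957 / 10000 :: real)" "ln 20 \<le> (29958 / 10000 :: real)"
      unfolding ln_20_eq using ln_2_bounds ln_5_bounds by simp_all
    have ln20k: "ln (20 * k) = ln 20 + ln k" using pos by (simp add: ln_mult)
    have ln200': "ln 200 \<le> (52984 / 10000 :: real)"
      unfolding ln_200_eq using ln_2_bounds ln_5_bounds by simp
    have sq: "sqrt (20 * k) \<le> 63.246 * v"
    proof (rule real_le_lsqrt)
      show "20 * k \<le> (63.246 * v)\<^sup>2" unfolding v(2) power_mult_distrib by (simp add: power2_eq_square)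
    qed (use v in auto)
    have lnsq: "ln (sqrt (20 * k)) = ln (20 * k) / 2" using pos by (simp add: ln_sqrt)
    have le: "ln (20 * k) \<le> 62942 / 10000 + 2 * v"
      using ln20k ln5k lnv ln20 ln200' by linarith
    have ge: "0 \<le> ln (20 * k)" using k by simp
    have "(21 / 2 + sqrt (20 * k) / 2) * ln (20 * k)
        \<le> (21 / 2 + 63.246 * v / 2) * (62942 / 10000 + 2 * v)"
      using sq le ge v by (intro mult_mono) auto
    also have "\<dots> \<le> 661 / 10 + 22005 / 100 * v + 63246 / 1000 * (v * v)"
      using v(1) by (simp add: algebra_simps)
    finally have 1: "(21 / 2 + sqrt (20 * k) / 2) * ln (20 * k)
        \<le> 661 / 10 + 22005 / 100 * v + 63246 / 1000 * (v * v)" .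
    have 2: "f (sqrt (20 * k)) - R
        = k * (ln 20 - 12624 / 10000) - (21 / 2 + sqrt (20 * k) / 2) * ln (20 * k) / 2
          - 15 * ln 2 - 15 * ln k - 47"
      unfolding f_def R_def lnk lnsq using ln20k by (simp add: field_simps)
    have "k * (17333 / 10000) \<le> k * (ln 20 - 12624 / 10000)"
      using ln20 pos by (intro mult_left_mono) auto
    hence 3: "34666 / 100 * (v * v) \<le> k * (ln 20 - 12624 / 10000)"
      unfolding v(2) by (simp add: power2_eq_square)
    have 4: "ln k \<le> 32984 / 10000 + 2 * v" using ln5k lnv ln200' by linarith
    have 5: "v \<le> v * v" using v mult_left_mono[of 1 v v] by simp
    have "ln 2 \<le> (693148 / 1000000 :: real)" using ln_2_bounds by simp
    thus ?thesis using 1 2 3 4 5 v(1) by linarith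
  qed
  have "concave_on {sqrt (20 * k)..k} f"
    unfolding f_def using k by (intro linear_times_ln_concave) auto
  from concave_on_ge_min[OF this] w(2,3) have "min (f (sqrt (20 * k))) (f k) \<le> f w" by simp
  hence fw: "R < f w" using 1 2 by linarith
  have "k / n \<le> ln (n / (n - k))"
  proof -
    have "ln ((n - k) / n) \<le> (n - k) / n - 1" using pos by (intro ln_le_minus_one) auto
    thus ?thesis using pos by (simp add: ln_div field_simps)
  qed
  hence "(n - k) * (k / n) \<le> (n - k) * (ln n - ln (n - k))"
    using pos by (intro mult_left_mono) (auto simp: ln_div)
  moreover have "95 / 100 * k \<le> (n - k) * (k / n)"
  proof -
    have "k * (95 / 100 * n) \<le> k * (n - k)" using n pos by (intro mult_left_mono) auto
    thus ?thesis using pos by (simp add: field_simps)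
  qed
  ultimately have "95 / 100 * k \<le> (n - k) * (ln n - ln (n - k))" by linarith
  moreover have "n * ln n - k * ln k - (n - k) * ln (n - k) - 2 * ln n - 1
      - (5531 / 5000 * (2 * k) + 15 * ln (2 * k) + 46 + (sqrt n + 13) / 4 * ln n)
    = (n - k) * (ln n - ln (n - k)) - 95 / 100 * k + (f w - R)"
    unfolding f_def R_def w_def[symmetric] lnn by (simp add: field_simps)
  ultimately show ?thesis using fw by linarith
qed

text \<open>The critical case is \<open>n = 4k\<close>, where the entropy \<open>H (1/4) = 0.5623\<close> barely exceeds
  \<open>1.1062 / 2\<close>.\<close>

lemma dense_estimate:
  fixes k n :: real
  assumes k: "0 < k" and n: "262140 \<le> n" "2 * k \<le> n" "n \<le> 20 * k"
    and b: "0 < b" "b \<le> 2 * k" "b \<le> n / 2"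
  shows "5531 / 5000 * b + 15 * ln b + 46 + (sqrt n + 13) / 4 * ln n
    < n * ln n - k * ln k - (n - k) * ln (n - k) - 2 * ln n - 1"
proof -
  define H where "H c q = - q * ln q - (1 - q) * ln (1 - q) - c * q" for c q :: real
  define q where "q = k / n"
  have pos: "0 < n" "k < n" using n k by linarith+
  have q: "0 < q" "q < 1" "1 / 20 \<le> q" "q \<le> 1 / 2" "k = q * n"
    using pos k n by (auto simp: q_def field_simps)
  have ent: "n * ln n - k * ln k - (n - k) * ln (n - k) = n * H 0 q"
  proof -
    have "n - k = (1 - q) * n" using q(5) by (simp add: algebra_simps)
    hence "ln (n - k) = ln (1 - q) + ln n" using q pos by (simp add: ln_mult)
    moreover have "ln k = ln q + ln n" using q pos by (simp add: ln_mult)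
    ultimately show ?thesis unfolding H_def using q(5) by (simp add: algebra_simps)
  qed
  have quarter: "H c (1 / 4) = 2 * ln 2 - 3 / 4 * ln 3 - c / 4" for c
  proof -
    have "ln (1 / 4) = - (2 * ln (2::real))" using ln_realpow[of 2 2] by (simp add: ln_div)
    moreover have "ln (3 / 4) = ln 3 - 2 * ln (2::real)" using ln_realpow[of 2 2] by (simp add: ln_div)
    ultimately show ?thesis by (simp add: H_def field_simps)
  qed
  have half: "H 0 (1 / 2) = ln 2" by (simp add: H_def ln_div)
  have twentieth: "19 / 100 \<le> H 0 (1 / 20)"
  proof -
    have "ln (1 / 20) = - (2 * ln 2 + ln (5::real))"
      using ln_20_eq by (simp add: ln_div)
    moreover have "ln (19 / 20) \<le> 19 / 20 - (1::real)" by (rule ln_le_minus_one) simp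
    ultimately show ?thesis using ln_2_bounds ln_5_bounds by (simp add: H_def field_simps)
  qed
  \<comment> \<open>Up to q = 1/4 the bound \<open>b \<le> 2 * k\<close> is used, beyond it
    \<open>b \<le> n / 2\<close>; concavity of the entropy leaves only end points. The reserve is
    0.5623 - 0.5531 = 0.0092.\<close>
  have main: "5531 / 5000 * b + 92 / 10000 * n \<le> n * H 0 q"
  proof (cases "q \<le> 1 / 4")
    case True
    have "min (H (11062 / 5000) (1 / 20)) (H (11062 / 5000) (1 / 4)) \<le> H (11062 / 5000) q"
      unfolding H_def using True q by (intro concave_on_ge_min[OF binary_entropy_concave]) auto
    moreover have "H (11062 / 5000) (1 / 20) \<ge> 92 / 10000"
      using twentieth by (simp add: H_def)
    moreover have "H (11062 / 5000) (1 / 4) \<ge> 92 / 10000"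
      using quarter[of "11062 / 5000"] ln_2_bounds ln_3_bounds by simp
    ultimately have "92 / 10000 \<le> H (11062 / 5000) q" by linarith
    hence "n * (92 / 10000 + 11062 / 5000 * q) \<le> n * H 0 q"
      using pos by (intro mult_left_mono) (auto simp: H_def)
    thus ?thesis using b(2) unfolding q(5) by (simp add: algebra_simps)
  next
    case False
    have "min (H 0 (1 / 4)) (H 0 (1 / 2)) \<le> H 0 q"
      unfolding H_def using False q by (intro concave_on_ge_min[OF binary_entropy_concave]) auto
    hence "5623 / 10000 \<le> H 0 q"
      using quarter[of 0] half ln_2_bounds ln_3_bounds by simp
    hence "n * (5623 / 10000) \<le> n * H 0 q" using pos by (intro mult_left_mono) auto
    thus ?thesis using b(3) by simp
  qed
  define x where "x = sqrt n"
  have x: "0 < x" "n = x\<^sup>2" using pos by (auto simp: x_def)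
  have "511 \<le> x" unfolding x_def using n by (intro real_le_rsqrt) simp
  have lnn: "ln n = 2 * ln x" using x by (simp add: ln_realpow)
  \<comment> \<open>The tangent of ln at 512 = 2^9, close to the least possible x.\<close>
  have "ln (x / 512) \<le> x / 512 - 1" using x by (intro ln_le_minus_one) simp
  moreover have "ln (512::real) = 9 * ln 2" using ln_realpow[of 2 9] by simp
  ultimately have lnx: "ln x \<le> 5239 / 1000 + x / 512"
    using x ln_2_bounds by (simp add: ln_div)
  have "(x / 2 + 81 / 2) * ln x \<le> (x / 2 + 81 / 2) * (5239 / 1000 + x / 512)"
    using lnx x by (intro mult_left_mono) auto
  also have "\<dots> \<le> x * x / 1024 + 27 / 10 * x + 2122 / 10"
    using x(1) by (simp add: field_simps)
  finally have "(x / 2 + 81 / 2) * ln x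
      \<le> x * x / 1024 + 27 / 10 * x + 2122 / 10" .
  moreover have "511 * x \<le> x * x" using \<open>511 \<le> x\<close> x by (intro mult_right_mono) auto
  ultimately have "(x / 2 + 81 / 2) * ln x + 47 < 92 / 10000 * n"
    using \<open>511 \<le> x\<close> unfolding x(2) power2_eq_square by linarith
  moreover have "ln b \<le> ln n" using b pos by simp
  ultimately show ?thesis using main ent lnn unfolding x_def[symmetric] by (simp add: field_simps)
qed

section \<open>Runs of composite numbers\<close>

text \<open>The run contains no prime, so it lies strictly between the \<open>q\<close> and
  \<open>q'\<close> of the table, and the gap exceeds \<open>k\<close>. This excludes the ranges of
  q with gaps of at most 14 or 34; beyond them it gives k < q/20.\<close>

lemma smooth_run_gap:
  assumes run: "smooth_run n k" and k: "14 \<le> k" "2 * k \<le> n" and small: "n - k + 1 \<le> 262139"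
  shows "500 < n - k + 1" and "34 \<le> k \<Longrightarrow> 1300 < n - k + 1 \<and> 20 * k \<le> n"
proof -
  have "11 < n - k + 1" using k by linarith
  then obtain q q' where q: "q < n - k + 1" "n - k + 1 \<le> q'" "prime q'"
    "q' \<le> q + (if q < 500 then 14 else if q < 1300 then 34 else q div 20)"
    using small by (rule ex_prime_gap)
  have "n < q'"
  proof (rule ccontr)
    assume "\<not> ?thesis"
    hence i: "n - q' < k" "n - (n - q') = q'" using q(2) k by linarith+
    have "\<not> prime (n - (n - q'))" using run i(1) unfolding smooth_run_def by blast
    thus False using q(3) unfolding i(2) by contradiction
  qed
  hence less: "k < (if q < 500 then 14 else if q < 1300 then 34 else q div 20)"
    using q(1,4) k by linarith
  thus "500 < n - k + 1" using q(1) k(1) by (cases "q < 500") auto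
  assume "34 \<le> k"
  hence "1300 \<le> q" "k < q div 20" using less by (auto split: if_splits)
  thus "1300 < n - k + 1 \<and> 20 * k \<le> n" using q(1) k by linarith
qed

text \<open>The comparison with factorials puts \<open>n - k + 1\<close> below 500 or 1300, the
  prime gaps put it above.\<close>

lemma not_smooth_run_medium:
  assumes "14 \<le> k" "k < 200" "2 * k \<le> n"
  shows "\<not> smooth_run n k"
proof
  assume run: "smooth_run n k"
  show False
  proof (cases "k \<le> 33")
    case True
    hence "n - k + 1 < 500"
      using assms by (intro smooth_run_imp_less[OF run] fact_less_500_power) auto
    thus False using smooth_run_gap(1)[OF run] assms by linarith
  next
    case False
    hence "n - k + 1 < 1300"
      using assms by (intro smooth_run_imp_less[OF run] fact_less_1300_power) auto
    thus False using smooth_run_gap(2)[OF run] assms False by linarith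
  qed
qed

lemma smooth_run_prime_dvd_binomial:
  assumes run: "smooth_run n k" and k: "1 \<le> k" "2 * k \<le> n" and p: "prime p" "p dvd n choose k"
  shows "p \<le> 2 * k" and "2 * p \<le> n"
proof -
  have "p dvd (\<Prod>j<k. n - j)" using p(2) by (simp add: prod_consecutive_eq)
  then obtain j where j: "j < k" "p dvd n - j" using p(1) by (auto simp: prime_dvd_prod_iff)
  show "p \<le> 2 * k" using run p(1) j unfolding smooth_run_def by blast
  obtain c where c: "n - j = p * c" using j(2) by blast
  have "\<not> prime (n - j)" using run j(1) unfolding smooth_run_def by blast
  hence "c \<noteq> 1" using c p(1) by auto
  moreover have "c \<noteq> 0" using c j(1) k by (intro notI) simp
  ultimately have "p * 2 \<le> n - j" unfolding c by (intro mult_le_mono2) simp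
  thus "2 * p \<le> n" by simp
qed

text \<open>(n/k)^k \<le> \<open>n choose k\<close> \<le> n^pi(2k) \<le> n^(k/2), where the last
  step needs 2k \<ge> 120.\<close>

lemma smooth_run_le_square:
  assumes run: "smooth_run n k" and k: "60 \<le> k" "2 * k \<le> n"
  shows "n \<le> k\<^sup>2"
proof -
  have pc: "real (prime_count (2 * k)) \<le> real k / 2"
    using four_prime_count_le_max[of "2 * k"] k by simp
  have "(real n / real k) ^ k \<le> real (n choose k)"
    using k binomial_ge_n_over_k_pow_k[of k n, where 'a = real] by simp
  hence "ln ((real n / real k) ^ k) \<le> ln (real (n choose k))"
    using k by (subst ln_le_cancel_iff) auto
  hence "real k * (ln (real n) - ln (real k)) \<le> ln (real (n choose k))"
    using k by (simp add: ln_realpow ln_div)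
  also have "\<dots> \<le> real (prime_count (2 * k)) * ln (real n)"
    using k by (intro ln_binomial_le_prime_count smooth_run_prime_dvd_binomial(1)[OF run]) auto
  also have "\<dots> \<le> real k / 2 * ln (real n)" using pc k by (intro mult_right_mono) auto
  finally have "real k * ln (real n) \<le> real k * (2 * ln (real k))" by (simp add: field_simps)
  hence "ln (real n) \<le> 2 * ln (real k)" using k by (subst (asm) mult_le_cancel_left_pos) auto
  also have "\<dots> = ln (real (k\<^sup>2))" using k by (simp add: ln_realpow)
  finally have "real n \<le> real (k\<^sup>2)" using k by (subst (asm) ln_le_cancel_iff) auto
  thus ?thesis by (simp only: of_nat_le_iff)
qed

lemma not_smooth_run_long:
  assumes k: "200 \<le> k" "2 * k \<le> n"
  shows "\<not> smooth_run n k"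
proof
  assume run: "smooth_run n k"
  define b where "b = min (2 * k) (n div 2)"
  define s where "s = nat \<lfloor>sqrt (real n)\<rfloor>"
  have s: "real s \<le> sqrt (real n)" "sqrt (real n) < real s + 1" unfolding s_def by (simp_all add: of_nat_nat)
  have "real n = (sqrt (real n))\<^sup>2" by simp
  also have "\<dots> < (real s + 1)\<^sup>2" using s(2) by (intro power_strict_mono) auto
  finally have "real n < real ((Suc s)\<^sup>2)" by (simp add: add.commute)
  hence s2: "n < (Suc s)\<^sup>2" by (simp only: of_nat_less_iff)
  have "ln (real (n choose k)) \<le> theta b + real (prime_count s) * ln (real n)"
  proof (rule ln_binomial_le_theta[OF _ _ _ s2])
    show "p \<le> b" if "prime p" "p dvd n choose k" for p
      using smooth_run_prime_dvd_binomial[OF run _ k(2) that] k by (auto simp: b_def)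
  qed (use k in auto)
  also have "theta b \<le> 5531 / 5000 * real b + 15 * ln (real b) + 46"
    using k by (intro theta_le) (auto simp: b_def)
  also have "real (prime_count s) * ln (real n) \<le> (sqrt (real n) + 13) / 4 * ln (real n)"
  proof (rule mult_right_mono)
    have "real (4 * prime_count s) \<le> real (s + 13)" using four_prime_count_le by (rule of_nat_mono)
    thus "real (prime_count s) \<le> (sqrt (real n) + 13) / 4" using s(1) by simp
  qed (use k in auto)
  finally have upper: "ln (real (n choose k))
      \<le> 5531 / 5000 * real b + 15 * ln (real b) + 46 + (sqrt (real n) + 13) / 4 * ln (real n)"
    by simp
  have lower: "real n * ln (real n) - real k * ln (real k) - (real n - real k) * ln (real n - real k)
      - 2 * ln (real n) - 1 \<le> ln (real (n choose k))"
    using k by (intro ln_binomial_ge) auto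
  have b: "1 \<le> real b" "real b \<le> 2 * real k" "real b \<le> real n / 2"
    using k unfolding b_def by linarith+
  show False
  proof (cases "20 * k \<le> n")
    case True
    have "real n \<le> (real k)\<^sup>2"
      unfolding of_nat_power[symmetric] using k by (intro of_nat_mono smooth_run_le_square[OF run]) auto
    moreover have "20 * real k \<le> real n" using True by linarith
    ultimately have "5531 / 5000 * (2 * real k) + 15 * ln (2 * real k) + 46 + (sqrt (real n) + 13) / 4 * ln (real n)
        < real n * ln (real n) - real k * ln (real k) - (real n - real k) * ln (real n - real k)
          - 2 * ln (real n) - 1"
      using k by (intro sparse_estimate) auto
    moreover have "ln (real b) \<le> ln (2 * real k)" using b by simp
    ultimately show False using upper lower b by linarith
  next
    case False
    \<comment> \<open>For \<open>n - k + 1 \<le> 262139\<close> the prime gaps would give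
      \<open>20 * k \<le> n\<close>.\<close>
    hence "262140 \<le> n" using smooth_run_gap(2)[OF run _ k(2)] k by linarith
    hence "5531 / 5000 * real b + 15 * ln (real b) + 46 + (sqrt (real n) + 13) / 4 * ln (real n)
        < real n * ln (real n) - real k * ln (real k) - (real n - real k) * ln (real n - real k)
          - 2 * ln (real n) - 1"
      using k False b by (intro dense_estimate) linarith+
    thus False using upper lower by linarith
  qed
qed

lemma not_smooth_run:
  assumes "10 < n" "2 \<le> k" "2 * k \<le> n"
  shows "\<not> smooth_run n k"
  using not_smooth_run_short[of n k] not_smooth_run_medium[of k n] not_smooth_run_long[of k n] assms
  by linarith

section \<open>The kernel of the valuation matrix\<close>

text \<open>With columns indexed by m = n - j, row (p, r) maps y to the difference of this sum at
  the shifts r and 0.\<close>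

definition valuation_sum :: "nat \<Rightarrow> (nat \<Rightarrow> rat) \<Rightarrow> nat \<Rightarrow> nat \<Rightarrow> rat" where
  "valuation_sum n y p r = (\<Sum>m = 1..n. y m * of_nat (multiplicity p (m + r)))"

definition in_kernel :: "nat \<Rightarrow> (nat \<Rightarrow> rat) \<Rightarrow> bool" where
  "in_kernel n y \<longleftrightarrow>
    (\<forall>p r. prime p \<longrightarrow> p \<le> n \<longrightarrow> r \<in> row_shifts n p \<longrightarrow> valuation_sum n y p r = valuation_sum n y p 0)"

text \<open>The exceptional sets of shifts contain the generic range, so this holds for every n; r =
  0 is included for convenience.\<close>

lemma in_kernelD:
  assumes "in_kernel n y" "prime p" "p \<le> n" "r + n mod p < p"
  shows "valuation_sum n y p r = valuation_sum n y p 0"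
proof (cases "r = 0")
  case False
  hence r: "r \<in> {1..p - n mod p - 1}" using assms(4) by auto
  have "r \<in> row_shifts n p"
  proof -
    have "r \<in> {1, 2}" if "\<exists>s>1. n = 2 ^ s" "p = 2" using r that by auto
    moreover have "r \<in> {1, 2, 3, 4}" if "n = 9" "p = 3" using r that by auto
    ultimately show ?thesis using r unfolding row_shifts_def by (simp split: if_splits)
  qed
  thus ?thesis using assms unfolding in_kernel_def by blast
qed simp

text \<open>For generic rows both valuations are 0, as no carry occurs in n mod p + i. In the
  exceptional rows the new terms are 2^s + 2, twice an odd number, and 12 = 3 * 4.\<close>

lemma multiplicity_add_row_shift:
  assumes "prime p" "r \<in> row_shifts n p" "i \<in> {1..r}"
  shows "multiplicity p (n + i) = multiplicity p i"
proof -
  consider s where "1 < s" "n = 2 ^ s" "p = 2" "1 \<le> i" "i \<le> 2" | "n = 9" "p = 3" "1 \<le> i" "i \<le> 4"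
    | "r \<in> {1..p - n mod p - 1}"
    using assms(2,3) unfolding row_shifts_def by (auto split: if_splits)
  thus ?thesis
  proof cases
    case 1
    then obtain t where t: "s = Suc t" "0 < t" by (cases s) auto
    have "multiplicity 2 (2 * (2 ^ t + 1 :: nat)) = Suc (multiplicity 2 (2 ^ t + 1 :: nat))"
      by (rule multiplicity_times_same) auto
    moreover have "multiplicity 2 (2 ^ t + 1 :: nat) = 0" using t by (intro not_dvd_imp_multiplicity_0) auto
    ultimately have "multiplicity 2 (n + 2) = 1" using 1 t by (simp add: algebra_simps)
    moreover have "multiplicity 2 (n + 1) = 0" using 1 by (intro not_dvd_imp_multiplicity_0) auto
    moreover have "i = 1 \<or> i = 2" using 1 by auto
    ultimately show ?thesis using 1(3) by auto
  next
    case 2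
    have "multiplicity 3 (3 * 4 :: nat) = Suc (multiplicity 3 (4::nat))"
      by (rule multiplicity_times_same) auto
    moreover have "i = 1 \<or> i = 2 \<or> i = 3 \<or> i = 4" using 2 by auto
    ultimately show ?thesis using 2(1,2) by (auto simp: not_dvd_imp_multiplicity_0)
  next
    case 3
    hence less: "n mod p + i < p" using assms(3) by auto
    hence "(n + i) mod p = n mod p + i" by (metis add.commute mod_add_left_eq mod_less)
    hence "\<not> p dvd n + i" "\<not> p dvd i"
      using assms(3) less by (auto simp: dvd_eq_mod_eq_0)
    thus ?thesis by (simp add: not_dvd_imp_multiplicity_0)
  qed
qed

text \<open>Shifting the window {1..n} by r drops the valuations of 1, ..., r and adds those of n +
  1, ..., n + r, which are the same.\<close>

lemma in_kernel_const: "in_kernel n (\<lambda>_. c)"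
  unfolding in_kernel_def
proof (intro allI impI)
  fix p r assume p: "prime p" and r: "r \<in> row_shifts n p"
  have "(\<Sum>m = 1..n. multiplicity p (m + r)) + (\<Sum>m = 1..r. multiplicity p m)
      = (\<Sum>m = 1..n + r. multiplicity p m)"
  proof -
    have "{1..n + r} = {1..r} \<union> {r + 1..n + r}" by auto
    hence "(\<Sum>m = 1..n + r. multiplicity p m)
        = (\<Sum>m = 1..r. multiplicity p m) + (\<Sum>m = r + 1..n + r. multiplicity p m)"
      by (simp add: sum.union_disjoint disjoint_iff)
    also have "(\<Sum>m = r + 1..n + r. multiplicity p m) = (\<Sum>m = 1..n. multiplicity p (m + r))"
      by (rule sum.reindex_bij_witness[of _ "\<lambda>m. m + r" "\<lambda>m. m - r"]) auto
    finally show ?thesis by simp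
  qed
  also have "\<dots> = (\<Sum>m = 1..n. multiplicity p m) + (\<Sum>i = 1..r. multiplicity p (n + i))"
  proof -
    have "{1..n + r} = {1..n} \<union> {n + 1..n + r}" by auto
    hence "(\<Sum>m = 1..n + r. multiplicity p m)
        = (\<Sum>m = 1..n. multiplicity p m) + (\<Sum>m = n + 1..n + r. multiplicity p m)"
      by (simp add: sum.union_disjoint disjoint_iff)
    also have "(\<Sum>m = n + 1..n + r. multiplicity p m) = (\<Sum>i = 1..r. multiplicity p (n + i))"
      by (rule sum.reindex_bij_witness[of _ "\<lambda>i. n + i" "\<lambda>m. m - n"]) auto
    finally show ?thesis .
  qed
  also have "(\<Sum>i = 1..r. multiplicity p (n + i)) = (\<Sum>i = 1..r. multiplicity p i)"
    using p r by (intro sum.cong refl multiplicity_add_row_shift)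
  finally have "(\<Sum>m = 1..n. multiplicity p (m + r)) = (\<Sum>m = 1..n. multiplicity p (m + 0))" by simp
  hence "c * of_nat (\<Sum>m = 1..n. multiplicity p (m + r)) = c * of_nat (\<Sum>m = 1..n. multiplicity p (m + 0))"
    by (simp only:)
  thus "valuation_sum n (\<lambda>_. c) p r = valuation_sum n (\<lambda>_. c) p 0"
    unfolding valuation_sum_def by (simp add: sum_distrib_left)
qed

lemma valuation_sum_diff:
  "valuation_sum n (\<lambda>m. y m - z m) p r = valuation_sum n y p r - valuation_sum n z p r"
  unfolding valuation_sum_def by (simp add: left_diff_distrib sum_subtractf)

lemma in_kernel_diff: "in_kernel n y \<Longrightarrow> in_kernel n z \<Longrightarrow> in_kernel n (\<lambda>m. y m - z m)"
  unfolding in_kernel_def valuation_sum_diff by metis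

lemma not_dvd_between:
  fixes a p q :: nat
  assumes "q * p < a" "a < q * p + p"
  shows "\<not> p dvd a"
proof
  assume "p dvd a"
  then obtain c where c: "a = p * c" by blast
  have "p * q < p * c" "p * c < p * (q + 1)" using assms unfolding c by (simp_all add: algebra_simps)
  hence "q < c" "c < q + 1" by (simp_all only: mult_less_cancel1)
  thus False by simp
qed

lemma valuation_sum_single:
  assumes "m \<in> {1..n}"
    and "\<And>m'. m' \<in> {1..n} \<Longrightarrow> m' \<noteq> m \<Longrightarrow> y m' = 0 \<or> \<not> p dvd m' + r"
  shows "valuation_sum n y p r = y m * of_nat (multiplicity p (m + r))"
proof -
  have "valuation_sum n y p r = y m * of_nat (multiplicity p (m + r))
      + (\<Sum>m'\<in>{1..n} - {m}. y m' * of_nat (multiplicity p (m' + r)))"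
    unfolding valuation_sum_def using assms(1) by (intro sum.remove) auto
  also have "(\<Sum>m'\<in>{1..n} - {m}. y m' * of_nat (multiplicity p (m' + r))) = 0"
  proof (rule sum.neutral, intro ballI)
    fix m' assume m': "m' \<in> {1..n} - {m}"
    hence "y m' = 0 \<or> \<not> p dvd m' + r" using assms(2)[of m'] by blast
    thus "y m' * of_nat (multiplicity p (m' + r)) = 0" by (auto simp: not_dvd_imp_multiplicity_0)
  qed
  finally show ?thesis by simp
qed

text \<open>For k = 0 this says that y is zero on all of {1..n}; for 2k \<ge> n it says
  nothing.\<close>

definition vanishes_inside :: "nat \<Rightarrow> (nat \<Rightarrow> rat) \<Rightarrow> nat \<Rightarrow> bool" where
  "vanishes_inside n y k \<longleftrightarrow> (\<forall>m. k < m \<longrightarrow> m + k \<le> n \<longrightarrow> y m = 0)"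

text \<open>The sum for the shift \<open>k\<close> meets no nonzero entry of \<open>y\<close>, so all the sums vanish; the
  other shifts each meet exactly one entry.\<close>

lemma vanishes_inside_mod:
  assumes ker: "in_kernel n y" and van: "vanishes_inside n y k"
    and p: "prime p" "p \<le> n" "2 * k < p" "n mod p < k"
  shows "vanishes_inside n y (n mod p)"
proof -
  define q c where "q = n div p" and "c = n mod p"
  have n: "n = q * p + c" by (simp add: q_def c_def)
  have c: "c < k" using p(4) by (simp add: c_def)
  have "q \<noteq> 0" using p(2) prime_gt_0_nat[OF p(1)] by (simp add: q_def div_eq_0_iff)
  hence qp: "p \<le> q * p" by simp
  have cases: "m \<le> k \<or> n < m + k \<or> y m = 0" for m
    using van unfolding vanishes_inside_def by (meson not_less)
  have "valuation_sum n y p k = 0"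
    unfolding valuation_sum_def
  proof (rule sum.neutral, intro ballI)
    fix m assume m: "m \<in> {1..n}"
    have "y m = 0 \<or> \<not> p dvd m + k"
    proof (cases "m \<le> k")
      case True
      thus ?thesis using m c p by (intro disjI2 not_dvd_between[of 0]) auto
    next
      case False
      have "\<not> p dvd m + k" if "n < m + k"
        using that m c p(3) n by (intro not_dvd_between[of q]) auto
      thus ?thesis using cases[of m] False by blast
    qed
    thus "y m * of_nat (multiplicity p (m + k)) = 0" by (auto simp: not_dvd_imp_multiplicity_0)
  qed
  hence zero: "valuation_sum n y p r = 0" if "r + c < p" for r
    using in_kernelD[OF ker p(1,2), of k] in_kernelD[OF ker p(1,2), of r] that c p(3)
    unfolding c_def[symmetric] by simp
  \<comment> \<open>The shift moves m to \<open>q * p\<close>, the largest multiple of p up to n; no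
    other possible support index meets a multiple, because p > 2k.\<close>
  have high: "y m = 0" if m: "n < m + k" "m + c \<le> n" for m
  proof -
    define r where "r = q * p - m"
    have r: "m + r = q * p" "r + c < k" using m n unfolding r_def by linarith+
    have "valuation_sum n y p r = y m * of_nat (multiplicity p (m + r))"
    proof (rule valuation_sum_single)
      show "m \<in> {1..n}" using m qp p(2,3) c by auto
      fix m' assume m': "m' \<in> {1..n}" "m' \<noteq> m"
      show "y m' = 0 \<or> \<not> p dvd m' + r"
      proof (cases "m' \<le> k")
        case True
        thus ?thesis using m' r(2) p(3) by (intro disjI2 not_dvd_between[of 0]) auto
      next
        case False
        have "\<not> p dvd m' + r" if "n < m' + k"
        proof (cases "m' < m")
          case True
          have "(q - 1) * p + p = q * p" using \<open>q \<noteq> 0\<close> by (cases q) auto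
          thus ?thesis using True that r m p(3) n by (intro not_dvd_between[of "q - 1"]) linarith+
        next
          case False
          thus ?thesis using that m' r p(3) c n by (intro not_dvd_between[of q]) auto
        qed
        thus ?thesis using cases[of m'] False by blast
      qed
    qed
    moreover have "valuation_sum n y p r = 0" using r(2) p(3) by (intro zero) linarith
    moreover have "multiplicity p (m + r) \<noteq> 0"
      unfolding r(1) using p(1) \<open>q \<noteq> 0\<close> prime_gt_0_nat[OF p(1)]
      by (subst multiplicity_eq_zero_iff) (auto dest: not_prime_unit)
    ultimately show ?thesis by simp
  qed
  \<comment> \<open>Here the shift moves m to p itself.\<close>
  have low: "y m = 0" if m: "c < m" "m \<le> k" for m
  proof -
    define r where "r = p - m"
    have r: "m + r = p" "r + c < p" using m p(3) unfolding r_def by linarith+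
    have "valuation_sum n y p r = y m * of_nat (multiplicity p (m + r))"
    proof (rule valuation_sum_single)
      show "m \<in> {1..n}" using m p by auto
      fix m' assume m': "m' \<in> {1..n}" "m' \<noteq> m"
      show "y m' = 0 \<or> \<not> p dvd m' + r"
      proof (cases "m' \<le> k")
        case True
        show ?thesis
        proof (cases "m' < m")
          case True
          thus ?thesis using m' r m p(3) by (intro disjI2 not_dvd_between[of 0]) linarith+
        next
          case False
          thus ?thesis using m' r True m p(3) by (intro disjI2 not_dvd_between[of 1]) auto
        qed
      next
        case False
        have "\<not> p dvd m' + r" if "n < m' + k"
          using that m' r m p(3) n by (intro not_dvd_between[of q]) auto
        thus ?thesis using cases[of m'] False by blast
      qed
    qed
    moreover have "valuation_sum n y p r = 0" using r(2) by (rule zero)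
    moreover have "multiplicity p (m + r) = 1" unfolding r(1) using p(1) by simp
    ultimately show ?thesis by simp
  qed
  show ?thesis unfolding vanishes_inside_def c_def[symmetric]
  proof (intro allI impI)
    fix m assume "c < m" "m + c \<le> n"
    thus "y m = 0" using cases[of m] high low by blast
  qed
qed

text \<open>The shift p - m moves m to p, the only multiple of p in the shifted window because n + p
  - m < 2p. Hence the sum is y m, and for shift 0 it is y p.\<close>

lemma in_kernel_eq_middle:
  assumes ker: "in_kernel n y" and p: "prime p" "p \<le> n" "n < 2 * p" and m: "n - p < m" "m \<le> p"
  shows "y m = y p"
proof -
  have nmod: "n mod p = n - p" using p by (simp add: mod_if)
  have single: "valuation_sum n y p (p - m') = y m'" if "n - p < m'" "m' \<le> p" for m'
  proof -
    have "valuation_sum n y p (p - m') = y m' * of_nat (multiplicity p (m' + (p - m')))"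
    proof (rule valuation_sum_single)
      show "m' \<in> {1..n}" using that p by auto
      fix l assume l: "l \<in> {1..n}" "l \<noteq> m'"
      show "y l = 0 \<or> \<not> p dvd l + (p - m')"
      proof (cases "l < m'")
        case True
        thus ?thesis using l that by (intro disjI2 not_dvd_between[of 0]) auto
      next
        case False
        thus ?thesis using l that p by (intro disjI2 not_dvd_between[of 1]) auto
      qed
    qed
    thus ?thesis using that p(1) by simp
  qed
  have "valuation_sum n y p (p - m) = valuation_sum n y p 0"
    using m p by (intro in_kernelD[OF ker p(1,2)]) (auto simp: nmod)
  thus ?thesis using single[OF m] single[of p] p by simp
qed

section \<open>Exceptional cases: powers of two, 9 and 10\<close>

lemma multiplicity_rec:
  fixes p n :: nat
  assumes "prime p" "0 < n"
  shows "multiplicity p n = (if p dvd n then Suc (multiplicity p (n div p)) else 0)"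
proof (cases "p dvd n")
  case True
  then obtain c where c: "n = p * c" by blast
  hence "multiplicity p n = Suc (multiplicity p c)"
    using assms by (auto intro!: multiplicity_times_same dest: not_prime_unit)
  thus ?thesis using c assms by (auto dest: prime_gt_0_nat)
qed (simp add: not_dvd_imp_multiplicity_0)

text \<open>Only y 1 and y n can be nonzero. Shift 1 gives y 1 = s y n, and the additional shift 2
  gives y n = s y n with s > 1.\<close>

lemma vanishes_inside_power_of_2:
  assumes ker: "in_kernel n y" and van: "vanishes_inside n y 1" and n: "n = 2 ^ s" "1 < s"
  shows "vanishes_inside n y 0"
proof -
  have n4: "4 \<le> n"
  proof -
    have "(2::nat) ^ 2 \<le> 2 ^ s" using n(2) by (intro power_increasing) auto
    thus ?thesis using n(1) by simp
  qed
  have sum: "valuation_sum n y 2 r = y 1 * of_nat (multiplicity 2 (1 + r)) + y n * of_nat (multiplicity 2 (n + r))" for r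
  proof -
    have "valuation_sum n y 2 r = (\<Sum>m\<in>{1, n}. y m * of_nat (multiplicity 2 (m + r)))"
      unfolding valuation_sum_def using van n4
      by (intro sum.mono_neutral_right) (auto simp: vanishes_inside_def)
    thus ?thesis using n4 by simp
  qed
  have shifts: "row_shifts n 2 = {1, 2}" using n unfolding row_shifts_def by auto
  have eq: "valuation_sum n y 2 r = valuation_sum n y 2 0" if "r \<in> {1, 2}" for r
    using that n4 ker[unfolded in_kernel_def, rule_format, of 2 r, unfolded shifts] by simp
  have m2: "2 + n = 2 * (2 ^ (s - 1) + 1)" using n by (cases s) auto
  have "multiplicity 2 (2 ^ (s - 1) + 1 :: nat) = 0"
    using n(2) by (intro not_dvd_imp_multiplicity_0) (cases s; auto)
  hence "multiplicity 2 (n + 2) = 1"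
    unfolding add.commute[of n 2] m2 by (subst multiplicity_times_same) auto
  moreover have "multiplicity 2 (n + 1) = 0"
    using n by (intro not_dvd_imp_multiplicity_0) auto
  moreover have "multiplicity 2 n = s" unfolding n(1) by simp
  moreover have "multiplicity 2 (1 + 2 :: nat) = 0" by (intro not_dvd_imp_multiplicity_0) auto
  moreover have "multiplicity 2 (1 + 1 :: nat) = 1" by (simp add: multiplicity_rec)
  ultimately have "y 1 = y n * of_nat s" "y n = y n * of_nat s"
    using eq[of 1] eq[of 2] unfolding sum by simp_all
  hence "y n * (of_nat s - 1) = 0" by (simp add: algebra_simps)
  hence "y n = 0" using n(2) by simp
  moreover from this have "y 1 = 0" using \<open>y 1 = y n * of_nat s\<close> by simp
  moreover have "m = 1 \<or> m = n \<or> (1 < m \<and> m + 1 \<le> n)" if "0 < m" "m \<le> n" for m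
    using that by linarith
  ultimately have "y m = 0" if "0 < m" "m \<le> n" for m
    using van that unfolding vanishes_inside_def by blast
  thus ?thesis unfolding vanishes_inside_def by simp
qed

text \<open>The additional shift 3 gives y 9 = 0 and shift 2 then y 1 = 0; the shifts 1 and 4
  together remove y 2 and y 8.\<close>

lemma vanishes_inside_9:
  assumes ker: "in_kernel 9 y" and van: "vanishes_inside 9 y 2"
  shows "vanishes_inside 9 y 0"
proof -
  have y: "y 3 = 0" "y 4 = 0" "y 5 = 0" "y 6 = 0" "y 7 = 0"
    using van unfolding vanishes_inside_def by simp_all
  have set: "{1..9} = {1, 2, 3, 4, 5, 6, 7, 8, 9 :: nat}"
    unfolding set_eq_iff insert_iff empty_iff atLeastAtMost_iff by presburger
  have shifts: "row_shifts 9 3 = {1, 2, 3, 4}" unfolding row_shifts_def by simp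
  have eq: "valuation_sum 9 y 3 r = valuation_sum 9 y 3 0" if "r \<in> {1, 2, 3, 4}" for r
    using that ker[unfolded in_kernel_def, rule_format, of 3 r, unfolded shifts] by simp
  have vs: "valuation_sum 9 y p r = y 1 * of_nat (multiplicity p (1 + r))
      + y 2 * of_nat (multiplicity p (2 + r)) + y 8 * of_nat (multiplicity p (8 + r))
      + y 9 * of_nat (multiplicity p (9 + r))" for p r
    unfolding valuation_sum_def set using y by simp
  have "y 2 + 2 * y 8 = 2 * y 9" "y 1 = 2 * y 9" "y 9 = 2 * y 9" "y 2 + y 8 = 2 * y 9"
    using eq[of 1] eq[of 2] eq[of 3] eq[of 4]
    unfolding vs by (simp_all add: multiplicity_rec del: One_nat_def plus_1_eq_Suc)
  hence "y 1 = 0" "y 2 = 0" "y 8 = 0" "y 9 = 0" by simp_all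
  hence "y m = 0" if "m \<in> {1..9}" for m
    using that y unfolding set by (elim insertE emptyE) simp_all
  thus ?thesis unfolding vanishes_inside_def by simp
qed

text \<open>The numbers 10, 9, 8 do form a smooth run of length 3, so the descent does not apply.
  Six rows of the primes 2, 3 and 5 determine the six remaining entries.\<close>

lemma vanishes_inside_10:
  assumes ker: "in_kernel 10 y" and van: "vanishes_inside 10 y 3"
  shows "vanishes_inside 10 y 0"
proof -
  have y: "y 4 = 0" "y 5 = 0" "y 6 = 0" "y 7 = 0"
    using van unfolding vanishes_inside_def by simp_all
  have set: "{1..10} = {1, 2, 3, 4, 5, 6, 7, 8, 9, 10 :: nat}"
    unfolding set_eq_iff insert_iff empty_iff atLeastAtMost_iff by presburger
  have eq: "valuation_sum 10 y p r = valuation_sum 10 y p 0"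
    if "p \<in> {2, 3, 5}" "r + 10 mod p < p" for p r
    using that by (intro in_kernelD[OF ker]) auto
  have vs: "valuation_sum 10 y p r = y 1 * of_nat (multiplicity p (1 + r))
      + y 2 * of_nat (multiplicity p (2 + r)) + y 3 * of_nat (multiplicity p (3 + r))
      + y 8 * of_nat (multiplicity p (8 + r)) + y 9 * of_nat (multiplicity p (9 + r))
      + y 10 * of_nat (multiplicity p (10 + r))" for p r
    unfolding valuation_sum_def set using y by simp
  have "y 9 = y 10" "y 3 + y 8 = y 10" "y 2 = y 10" "y 1 = y 10"
    using eq[of 5 1] eq[of 5 2] eq[of 5 3] eq[of 5 4] unfolding vs by (simp_all add: multiplicity_rec del: One_nat_def plus_1_eq_Suc)
  moreover have "y 2 + 2 * y 8 = y 3 + 2 * y 9"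
    using eq[of 3 1] unfolding vs by (simp add: multiplicity_rec del: One_nat_def plus_1_eq_Suc)
  moreover have "y 1 + 2 * y 3 + y 9 = y 2 + 3 * y 8 + y 10"
    using eq[of 2 1] unfolding vs by (simp add: multiplicity_rec del: One_nat_def plus_1_eq_Suc)
  ultimately have "y 1 = 0" "y 2 = 0" "y 3 = 0" "y 8 = 0" "y 9 = 0" "y 10 = 0" by linarith+
  hence "y m = 0" if "m \<in> {1..10}" for m
    using that y unfolding set by (elim insertE emptyE) simp_all
  thus ?thesis unfolding vanishes_inside_def by simp
qed

section \<open>Kernel vectors are constant\<close>

text \<open>Bertrand's postulate in the form needed here. For n > 10 the upper half of {1..n} is no
  smooth run: it contains a prime, or a multiple of a prime above 2 (n div 2), which itself is large
  enough.\<close>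

lemma ex_large_prime:
  fixes n :: nat
  assumes "2 \<le> n"
  shows "\<exists>p. prime p \<and> p \<le> n \<and> n < 2 * p"
proof (cases "n \<le> 10")
  case True
  have "prime (2::nat)" "prime (3::nat)" "prime (5::nat)" "prime (7::nat)" by simp_all
  moreover have "(2 \<le> n \<and> n < 2 * 2) \<or> (3 \<le> n \<and> n < 2 * 3) \<or> (5 \<le> n \<and> n < 2 * 5) \<or> (7 \<le> n \<and> n < 2 * 7)"
    using True assms by linarith
  ultimately show ?thesis by blast
next
  case False
  define k where "k = n div 2"
  have k: "2 \<le> k" "2 * k \<le> n" "n \<le> 2 * k + 1" using False unfolding k_def by linarith+
  have "\<not> smooth_run n k" using False k by (intro not_smooth_run) auto
  then obtain i p where i: "i < k" "prime (n - i) \<or> (prime p \<and> p dvd n - i \<and> 2 * k < p)"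
    unfolding smooth_run_def by (auto simp: not_le)
  show ?thesis
  proof (cases "prime (n - i)")
    case True
    thus ?thesis using i(1) k by (intro exI[of _ "n - i"]) auto
  next
    case False
    hence p: "prime p" "p dvd n - i" "2 * k < p" using i(2) by blast+
    have "p \<le> n - i" using p(2) i(1) k by (intro dvd_imp_le) auto
    thus ?thesis using p k by (intro exI[of _ p]) auto
  qed
qed

text \<open>As k \<le> n - P for the largest prime P up to n, the numbers n, ..., n - k + 1 are
  composite. If a prime p > 2k divides n - i with i < k, then n mod p = i and the support shrinks
  from k to i.\<close>

lemma vanishes_inside_descent:
  assumes ker: "in_kernel n y" and n: "2 \<le> n"
    and P: "prime P" "P \<le> n" "n < 2 * P" "\<And>p. prime p \<Longrightarrow> p \<le> n \<Longrightarrow> p \<le> P"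
    and van: "vanishes_inside n y k" "k \<le> n - P"
  shows "vanishes_inside n y 0"
  using van
proof (induction k rule: less_induct)
  case (less k)
  have step: ?case if p: "prime p" "2 * k < p" "p dvd n - i" "i < k" for p i
  proof -
    obtain c where c: "n - i = p * c" using p(3) by blast
    have "i < n" using p(4) less.prems(2) by linarith
    hence "n = i + p * c" using c by linarith
    hence mod: "n mod p = i" using p(2,4) by simp
    have "p \<le> n - i" using p(3) \<open>i < n\<close> by (intro dvd_imp_le) auto
    hence "vanishes_inside n y i"
      using vanishes_inside_mod[OF ker less.prems(1) p(1) _ p(2)] p(4) unfolding mod by simp
    thus ?thesis using less.IH p(4) less.prems(2) by simp
  qed
  have composite: "\<not> prime (n - i)" if "i < k" for i
    using P(4)[of "n - i"] that less.prems(2) by linarith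
  have "k = 0 \<or> k = 1 \<or> 2 \<le> k \<and> (10 < n \<or> n = 9 \<and> k = 2 \<or> n = 10 \<and> k = 2 \<or> n = 10 \<and> k = 3
      \<or> n < 9 \<or> n = 9 \<and> 2 < k \<or> n = 10 \<and> 3 < k)"
    by linarith
  then consider "k = 0" | "k = 1" "\<exists>s>1. n = 2 ^ s" | "k = 1" "\<not> (\<exists>s>1. n = 2 ^ s)"
    | "2 \<le> k" "10 < n" | "n = 9" "k = 2" | "n = 10" "k = 2" | "n = 10" "k = 3" | "2 \<le> k" "n < 9"
    | "n = 9" "2 < k" | "n = 10" "3 < k"
    by blast
  thus ?case
  proof cases
    case 1
    thus ?thesis using less.prems(1) by simp
  next
    case 2
    thus ?thesis using vanishes_inside_power_of_2[OF ker] less.prems(1) by auto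
  next
    case 3
    \<comment> \<open>For k = 1 any odd prime factor of n exceeds 2k. The case n = 2 is excluded
      because n is composite.\<close>
    have "\<exists>p. prime p \<and> p dvd n \<and> p \<noteq> 2"
    proof (rule ccontr)
      assume "\<not> ?thesis"
      hence "prime_factors n \<subseteq> {2}" by auto
      moreover have "n = (\<Prod>p\<in>prime_factors n. p ^ multiplicity p n)"
        using n by (intro prime_factorization_nat) simp
      ultimately have "n = 2 ^ multiplicity 2 n" using n
        by (auto simp: subset_singleton_iff)
      moreover from this have "multiplicity 2 n \<noteq> 0" "multiplicity 2 n \<noteq> 1"
        using n composite[of 0] 3(1) by (auto intro!: notI)
      ultimately show False using 3(2) by (metis One_nat_def less_one linorder_neqE_nat)
    qed
    then obtain p where p: "prime p" "p dvd n" "p \<noteq> 2" by blast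
    hence "2 < p" using prime_ge_2_nat[OF p(1)] by linarith
    thus ?thesis using step[of p 0] p 3(1) by simp
  next
    case 4
    have "\<not> smooth_run n k" using 4 less.prems(2) P(3) by (intro not_smooth_run) linarith+
    then obtain i p where "i < k" "prime p" "p dvd n - i" "2 * k < p"
      using composite unfolding smooth_run_def by (auto simp: not_le)
    thus ?thesis using step by blast
  next
    case 5
    thus ?thesis using vanishes_inside_9 ker less.prems(1) by simp
  next
    case 6
    thus ?thesis using step[of 5 0] by simp
  next
    case 7
    thus ?thesis using vanishes_inside_10 ker less.prems(1) by simp
  next
    case 8
    have "prime (2::nat)" "prime (3::nat)" "prime (5::nat)" "prime (7::nat)" by simp_all
    \<comment> \<open>Below 9 the largest prime is n or n - 1, so k \<ge> 2 is impossible.\<close>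
    hence "n < P + 2" using P(4)[of 2] P(4)[of 3] P(4)[of 5] P(4)[of 7] 8(2) n by linarith
    thus ?thesis using 8(1) less.prems(2) by linarith
  next
    case 9
    have "7 \<le> P" using P(4)[of 7] 9 by simp
    thus ?thesis using 9 less.prems(2) by linarith
  next
    case 10
    have "7 \<le> P" using P(4)[of 7] 10 by simp
    thus ?thesis using 10 less.prems(2) by linarith
  qed
qed

lemma in_kernel_imp_const:
  assumes ker: "in_kernel n y" and n: "2 \<le> n" and m: "m \<in> {1..n}" "m' \<in> {1..n}"
  shows "y m = y m'"
proof -
  define P where "P = Max {p. prime p \<and> p \<le> n}"
  obtain p where p: "prime p" "p \<le> n" "n < 2 * p" using ex_large_prime[OF n] by blast
  have max: "q \<le> P" if "prime q" "q \<le> n" for q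
    unfolding P_def using that by (intro Max_ge) auto
  have "P \<in> {p. prime p \<and> p \<le> n}" unfolding P_def using p by (intro Max_in) auto
  hence P: "prime P" "P \<le> n" by simp_all
  have P2: "n < 2 * P" using max[OF p(1,2)] p(3) by linarith
  have ker': "in_kernel n (\<lambda>m. y m - y P)" by (rule in_kernel_diff[OF ker in_kernel_const])
  have van: "vanishes_inside n (\<lambda>m. y m - y P) (n - P)"
    unfolding vanishes_inside_def
  proof (intro allI impI)
    fix l assume "n - P < l" "l + (n - P) \<le> n"
    hence "y l = y P" using P(2) by (intro in_kernel_eq_middle[OF ker P P2]) auto
    thus "y l - y P = 0" by (rule right_minus_eq[THEN iffD2])
  qed
  have "vanishes_inside n (\<lambda>m. y m - y P) 0"
    by (rule vanishes_inside_descent[OF ker' n P P2 _ van order.refl]) (rule max)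
  hence "y l - y P = 0" if "l \<in> {1..n}" for l
    using that unfolding vanishes_inside_def by simp
  from this[OF m(1)] this[OF m(2)] show ?thesis by linarith
qed

theorem mainTheorem4:
  fixes n :: nat and prs :: "(nat \<times> nat) list"
  assumes "n \<ge> 2"
    and "distinct prs" and "set prs = row_index n"
  shows "rat_rank (valuation_matrix n prs) = n - 1"
proof -
  define A where "A = map_mat rat_of_int (valuation_matrix n prs)"
  define l where "l = length prs"
  have A: "A \<in> carrier_mat l n" by (simp add: A_def l_def valuation_matrix_def)
  have entry: "A $$ (i, j) = of_nat (multiplicity (fst (prs ! i)) (n + snd (prs ! i) - j))
      - of_nat (multiplicity (fst (prs ! i)) (n - j))" if "i < l" "j < n" for i j
    using that by (auto simp: A_def l_def valuation_matrix_def split: prod.splits)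
  have row: "(A *\<^sub>v v) $ i = valuation_sum n (\<lambda>m. v $ (n - m)) (fst (prs ! i)) (snd (prs ! i))
      - valuation_sum n (\<lambda>m. v $ (n - m)) (fst (prs ! i)) 0" if "i < l" "v \<in> carrier_vec n" for i v
  proof -
    obtain p r where pr: "prs ! i = (p, r)" by force
    have "(A *\<^sub>v v) $ i = (\<Sum>j = 0..<n. A $$ (i, j) * v $ j)"
      using that A by (simp add: scalar_prod_def)
    also have "\<dots> = (\<Sum>j = 0..<n. v $ j * of_nat (multiplicity p (n + r - j))
        - v $ j * of_nat (multiplicity p (n - j)))"
      using that by (intro sum.cong) (auto simp: entry pr algebra_simps)
    also have "\<dots> = (\<Sum>m = 1..n. v $ (n - m) * of_nat (multiplicity p (m + r))
        - v $ (n - m) * of_nat (multiplicity p (m + 0)))"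
      by (rule sum.reindex_bij_witness[of _ "\<lambda>m. n - m" "\<lambda>j. n - j"]) auto
    finally show ?thesis by (simp add: valuation_sum_def sum_subtractf pr)
  qed
  have zero_iff: "A *\<^sub>v v = 0\<^sub>v l \<longleftrightarrow> in_kernel n (\<lambda>m. v $ (n - m))" if v: "v \<in> carrier_vec n" for v
  proof -
    have "A *\<^sub>v v = 0\<^sub>v l \<longleftrightarrow> (\<forall>i<l. (A *\<^sub>v v) $ i = 0)"
    proof
      assume 0: "A *\<^sub>v v = 0\<^sub>v l"
      show "\<forall>i<l. (A *\<^sub>v v) $ i = 0" unfolding 0 by simp
    next
      assume "\<forall>i<l. (A *\<^sub>v v) $ i = 0"
      thus "A *\<^sub>v v = 0\<^sub>v l"
        by (intro eq_vecI) (use A in \<open>simp_all del: index_mult_mat_vec\<close>)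
    qed
    also have "\<dots> \<longleftrightarrow> (\<forall>i<l. valuation_sum n (\<lambda>m. v $ (n - m)) (fst (prs ! i)) (snd (prs ! i))
        = valuation_sum n (\<lambda>m. v $ (n - m)) (fst (prs ! i)) 0)"
      using row[OF _ v] by simp
    also have "\<dots> \<longleftrightarrow> (\<forall>x\<in>set prs. valuation_sum n (\<lambda>m. v $ (n - m)) (fst x) (snd x)
        = valuation_sum n (\<lambda>m. v $ (n - m)) (fst x) 0)"
      unfolding l_def by (simp only: all_set_conv_all_nth)
    also have "\<dots> \<longleftrightarrow> in_kernel n (\<lambda>m. v $ (n - m))"
      unfolding assms(3) row_index_def primes_upto_def in_kernel_def by auto
    finally show ?thesis .
  qed
  have dim: "dim_row (valuation_matrix n prs) = l" by (simp add: valuation_matrix_def l_def)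
  have one: "A *\<^sub>v vec n (\<lambda>_. 1) = 0\<^sub>v l"
  proof -
    have "in_kernel n (\<lambda>m. vec n (\<lambda>_. 1) $ (n - m)) = in_kernel n (\<lambda>m. 1)"
      unfolding in_kernel_def valuation_sum_def using assms(1) by (auto intro!: sum.cong)
    thus ?thesis using zero_iff[OF vec_carrier] in_kernel_const by blast
  qed
  have const: "v $ i = v $ 0" if v: "v \<in> carrier_vec n" "A *\<^sub>v v = 0\<^sub>v l" and i: "i < n" for v i
  proof -
    have "in_kernel n (\<lambda>m. v $ (n - m))" using zero_iff[OF v(1)] v(2) by blast
    \<comment> \<open>The columns i and 0 are the indices m = n - i and m = n.\<close>
    hence "v $ (n - (n - i)) = v $ (n - n)"
      by (rule in_kernel_imp_const[OF _ assms(1)]) (use i in auto)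
    thus ?thesis using i by (simp del: index_mult_mat_vec)
  qed
  have "(1::rat) \<noteq> - 1" by simp
  from vec_space.rank_eq_pred_if_kernel_constant[OF A assms(1) this one]
  have "vec_space.rank l A = n - 1" using const by blast
  thus ?thesis unfolding rat_rank_def dim A_def[symmetric] .
qed

end
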